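(* (i) If $\omega$ is a superharmonic weight and $f\in\mathcal D_\omega$, then $\|\sigma_n(f)-f\|_{\mathcal D_\omega}\to0$ as $n\to\infty$. (ii) There exist a superharmonic weight $\omega$ and a function $f\in\mathcal D_\omega$ such that $\|s_n(f)-f\|_{\mathcal D_\omega}\not\to0$ as $n\to\infty$.
   Context: $\mathbb D$ is the open unit disk, $dA$ is normalized area measure on $\mathbb D$. A superharmonic weight is a positive superharmonic function $\omega$ on $\mathbb D$. For $f$ holomorphic on $\mathbb D$, $\mathcal D_\omega(f):=\int_{\mathbb D}|f'(z)|^2\omega(z)\,dA(z)$, $\mathcal D_\omega$ is the space of holomorphic $f$ on $\mathbb D$ with $\mathcal D_\omega(f)<\infty$, with norm $\|f\|^2_{\mathcal D_\omega}=|f(0)|^2+\mathcal D_\omega(f)$. For $f(z)=\sum_{k\ge0}a_kz^k$, $s_n(f)(z):=\sum_{k=0}^na_kz^k$ and $\sigma_n(f):=\frac1{n+1}\sum_{k=0}^ns_k(f)$. *)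

theory Defs
  imports "HOL-Analysis.Analysis"
begin

abbreviation unit_disk :: "complex set" where
  "unit_disk \<equiv> ball 0 1"

text \<open>Superharmonic weight: a positive superharmonic function on the unit disk,
  with values in (0, +infinity]. Superharmonic: lower semicontinuous, not identically
  +infinity (the disk is connected), and satisfying the super-mean-value inequality
  on every closed disk contained in the unit disk.\<close>
definition superharmonic_weight :: "(complex \<Rightarrow> ennreal) \<Rightarrow> bool" where
  "superharmonic_weight \<omega> \<longleftrightarrow>
     (\<forall>z\<in>unit_disk. 0 < \<omega> z) \<and>
     (\<forall>z\<in>unit_disk. \<omega> z \<le> Liminf (at z) \<omega>) \<and>
     (\<exists>z\<in>unit_disk. \<omega> z < \<infinity>) \<and>
     (\<forall>a r. 0 < r \<longrightarrow> cball a r \<subseteq> unit_disk \<longrightarrow>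
        (\<integral>\<^sup>+ t\<in>{0..2*pi}. \<omega> (a + complex_of_real r * cis t) \<partial>lborel) / ennreal (2*pi) \<le> \<omega> a)"

text \<open>Weighted Dirichlet integral, with dA = normalized area measure (Lebesgue / pi).\<close>
definition dirichlet_integral :: "(complex \<Rightarrow> ennreal) \<Rightarrow> (complex \<Rightarrow> complex) \<Rightarrow> ennreal" where
  "dirichlet_integral \<omega> f =
     (\<integral>\<^sup>+ z\<in>unit_disk. ennreal ((cmod (deriv f z))\<^sup>2) * \<omega> z \<partial>lborel) / ennreal pi"

definition in_D :: "(complex \<Rightarrow> ennreal) \<Rightarrow> (complex \<Rightarrow> complex) \<Rightarrow> bool" where
  "in_D \<omega> f \<longleftrightarrow> f holomorphic_on unit_disk \<and> dirichlet_integral \<omega> f < \<infinity>"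

definition D_norm_sq :: "(complex \<Rightarrow> ennreal) \<Rightarrow> (complex \<Rightarrow> complex) \<Rightarrow> ennreal" where
  "D_norm_sq \<omega> f = ennreal ((cmod (f 0))\<^sup>2) + dirichlet_integral \<omega> f"

definition taylor_coeff :: "(complex \<Rightarrow> complex) \<Rightarrow> nat \<Rightarrow> complex" where
  "taylor_coeff f k = (deriv ^^ k) f 0 / of_nat (fact k)"

definition partial_sum :: "nat \<Rightarrow> (complex \<Rightarrow> complex) \<Rightarrow> complex \<Rightarrow> complex" where
  "partial_sum n f z = (\<Sum>k\<le>n. taylor_coeff f k * z ^ k)"

definition cesaro_mean :: "nat \<Rightarrow> (complex \<Rightarrow> complex) \<Rightarrow> complex \<Rightarrow> complex" where
  "cesaro_mean n f z = (\<Sum>k\<le>n. partial_sum k f z) / of_nat (n + 1)"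

end

theory Submission
  imports Defs "HOL-Complex_Analysis.Complex_Analysis"
begin

text \<open>
  Write \<open>D f\<close> for the integral of \<open>|f'|\<^sup>2 \<omega>\<close> over the disk. Testing superharmonicity against
  \<open>(1 - |z|\<^sup>2)\<^sup>2 |f|\<^sup>2\<close> shows that multiplication by \<open>z\<close> is a concave operator:
  \<open>D (z\<^sup>2 f) + D f \<le> 2 D (z f)\<close>. Since \<open>D \<ge> 0\<close>, iterating forces the defect
  \<open>q f = D (z f) - D f\<close> to be nonnegative, and concavity says \<open>q (z f) \<le> q f\<close>. As \<open>D\<close> ignores
  constants, \<open>D f\<close> is at least the sum of the defects of the Taylor tails \<open>g\<^sub>k\<close> of \<open>f\<close>, with equality
  for polynomials, and the tails of \<open>\<sigma>\<^sub>n f\<close> are combinations of the \<open>z\<^sup>j g\<^sub>k\<close> to which a Hardy-type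
  inequality for the quadratic form \<open>q\<close> applies; this gives \<open>D (\<sigma>\<^sub>n f) \<le> D f\<close>. Pointwise
  convergence of the derivatives turns this contractivity into \<open>D (\<sigma>\<^sub>n f - f) \<rightarrow> 0\<close>.

  For the partial sums take the Poisson kernel at \<open>1\<close> as weight, normalising \<open>D\<close> by \<open>1/\<pi>\<close>. Then
  \<open>D (z\<^sup>m) = m\<close> while \<open>D (z\<^sup>m\<^sup>+\<^sup>1 - z\<^sup>m) = 1\<close>, so \<open>f = \<Sum>\<^sub>j 2\<^sup>-\<^sup>j (z\<^sup>m\<^sup>+\<^sup>1 - z\<^sup>m)\<close> with
  \<open>m = 4\<^sup>j\<close> lies in the space, but its Taylor terms \<open>2\<^sup>-\<^sup>j z\<^sup>m\<close> do not tend to \<open>0\<close> in norm.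
\<close>

subsection \<open>Circle means\<close>

lemma nn_integral_lborel_translation:
  fixes g :: "'a::euclidean_space \<Rightarrow> ennreal"
  assumes [measurable]: "g \<in> borel_measurable borel"
  shows "(\<integral>\<^sup>+x. g (c + x) \<partial>lborel) = (\<integral>\<^sup>+x. g x \<partial>lborel)"
proof -
  have "(\<integral>\<^sup>+x. g x \<partial>lborel) = (\<integral>\<^sup>+x. g x \<partial>distr lborel borel ((+) c))"
    by (simp add: lborel_distr_plus)
  also have "\<dots> = (\<integral>\<^sup>+x. g (c + x) \<partial>lborel)"
    by (subst nn_integral_distr) auto
  finally show ?thesis by simp
qed

lemma borel_measurable_orthogonal_transformation:
  fixes T :: "'a::euclidean_space \<Rightarrow> 'a"
  assumes "orthogonal_transformation T"
  shows "T \<in> borel_measurable borel"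
  using orthogonal_transformation_linear[OF assms]
  by (intro borel_measurable_continuous_onI linear_continuous_on)
    (simp add: linear_conv_bounded_linear)

lemma nn_integral_lborel_linear_translation:
  fixes T :: "'a::euclidean_space \<Rightarrow> 'a" and g :: "'a \<Rightarrow> ennreal"
  assumes T: "linear T" "surj T"
    and [measurable]: "T \<in> borel_measurable borel" "g \<in> borel_measurable borel"
  shows "(\<integral>\<^sup>+x. g (T x + y) \<partial>lborel) = (\<integral>\<^sup>+x. g (T x) \<partial>lborel)"
proof -
  have "(\<integral>\<^sup>+x. g (T x) \<partial>lborel) = (\<integral>\<^sup>+x. g (T (inv T y + x)) \<partial>lborel)"
    by (rule nn_integral_lborel_translation[symmetric]) measurable
  then show ?thesis
    by (simp add: linear_add[OF T(1)] surj_f_inv_f[OF T(2)] add.commute)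
qed

text \<open>Uniqueness of Haar measure, made explicit: the product of \<open>g (T x + y)\<close> and the indicator
  \<open>B 0 y\<close> of the unit ball is integrated over \<open>x\<close> and \<open>y\<close> in both orders.\<close>

lemma nn_integral_lborel_orthogonal_transformation:
  fixes T :: "'a::euclidean_space \<Rightarrow> 'a" and g :: "'a \<Rightarrow> ennreal"
  assumes T: "orthogonal_transformation T" and [measurable]: "g \<in> borel_measurable borel"
  shows "(\<integral>\<^sup>+x. g (T x) \<partial>lborel) = (\<integral>\<^sup>+x. g x \<partial>lborel)"
proof -
  note linear = orthogonal_transformation_linear[OF T]
    and surj = orthogonal_transformation_surj[OF T]
  define S where "S = inv T"
  have [measurable]: "T \<in> borel_measurable borel" "S \<in> borel_measurable borel"
    unfolding S_def
    by (intro borel_measurable_orthogonal_transformation orthogonal_transformation_inv T)+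
  define B where "B y x = (indicator {..<1} (dist y x) :: ennreal)" for x y :: 'a
  define V where "V = emeasure lborel (ball (0::'a) 1)"
  have V: "V \<noteq> 0" "V \<noteq> \<infinity>"
    by (simp_all add: V_def emeasure_ball less_imp_neq[OF unit_ball_vol_pos, symmetric])
  have "B y = indicator (ball y 1)" for y
    by (auto simp: B_def indicator_def)
  then have B_integral: "(\<integral>\<^sup>+x. B y x \<partial>lborel) = V" for y
    by (simp add: V_def emeasure_ball)
  have [measurable]: "case_prod B \<in> borel_measurable (borel \<Otimes>\<^sub>M borel)"
    unfolding B_def by measurable
  have "V * (\<integral>\<^sup>+x. g (T x) \<partial>lborel) = (\<integral>\<^sup>+y. B 0 y * (\<integral>\<^sup>+x. g (T x) \<partial>lborel) \<partial>lborel)"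
    by (simp add: nn_integral_multc B_integral)
  also have "\<dots> = (\<integral>\<^sup>+y. \<integral>\<^sup>+x. B 0 y * g (T x + y) \<partial>lborel \<partial>lborel)"
  proof (rule nn_integral_cong)
    fix y
    show "B 0 y * (\<integral>\<^sup>+x. g (T x) \<partial>lborel) = (\<integral>\<^sup>+x. B 0 y * g (T x + y) \<partial>lborel)"
      by (simp add: nn_integral_cmult nn_integral_lborel_linear_translation[OF linear surj])
  qed
  also have "\<dots> = (\<integral>\<^sup>+x. \<integral>\<^sup>+y. B 0 y * g (T x + y) \<partial>lborel \<partial>lborel)"
    by (rule lborel_pair.Fubini') measurable
  also have "\<dots> = (\<integral>\<^sup>+x. \<integral>\<^sup>+y. B (S y) x * g y \<partial>lborel \<partial>lborel)"
  proof (rule nn_integral_cong)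
    fix x
    have "B 0 (- T x + y) = B (S y) x" for y
      using orthogonal_transformation_norm[OF T, of "x - S y"]
      by (simp add: B_def S_def dist_norm linear_diff[OF linear]
          surj_f_inv_f[OF surj] norm_minus_commute)
    then show "(\<integral>\<^sup>+y. B 0 y * g (T x + y) \<partial>lborel) = (\<integral>\<^sup>+y. B (S y) x * g y \<partial>lborel)"
      using nn_integral_lborel_translation[of "\<lambda>y. B 0 y * g (T x + y)" "- T x"] by simp
  qed
  also have "\<dots> = (\<integral>\<^sup>+y. \<integral>\<^sup>+x. B (S y) x * g y \<partial>lborel \<partial>lborel)"
    by (rule lborel_pair.Fubini') measurable
  also have "\<dots> = V * (\<integral>\<^sup>+x. g x \<partial>lborel)"
    by (simp add: nn_integral_multc nn_integral_cmult B_integral)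
  finally show ?thesis
    using V by (simp add: ennreal_mult_cancel_left)
qed

lemma orthogonal_transformation_mult_unit:
  assumes "cmod u = 1"
  shows "orthogonal_transformation ((*) u)"
  using assms by (simp add: orthogonal_transformation norm_mult linear_iff distrib_left)

lemma nn_integral_periodic_shift:
  fixes g :: "real \<Rightarrow> ennreal"
  assumes [measurable]: "g \<in> borel_measurable borel"
    and periodic: "\<And>t. g (p + t) = g t" and s: "0 \<le> s" "s \<le> p"
  shows "(\<integral>\<^sup>+t\<in>{0..p}. g (s + t) \<partial>lborel) = (\<integral>\<^sup>+t\<in>{0..p}. g t \<partial>lborel)"
proof -
  have "(\<integral>\<^sup>+t\<in>{0..p}. g (s + t) \<partial>lborel) = (\<integral>\<^sup>+t. g (s + t) * indicator {s..p + s} (s + t) \<partial>lborel)"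
    by (auto intro!: nn_integral_cong simp: indicator_def)
  also have "\<dots> = (\<integral>\<^sup>+t\<in>{s..p + s}. g t \<partial>lborel)"
    by (rule nn_integral_lborel_translation) measurable
  also have "\<dots> = (\<integral>\<^sup>+t\<in>{s..<p} \<union> {p..p + s}. g t \<partial>lborel)"
    using s by (simp add: ivl_disj_un)
  also have "\<dots> = (\<integral>\<^sup>+t\<in>{s..<p}. g t \<partial>lborel) + (\<integral>\<^sup>+t\<in>{p..p + s}. g t \<partial>lborel)"
    by (rule nn_integral_disjoint_pair) auto
  also have "(\<integral>\<^sup>+t\<in>{p..p + s}. g t \<partial>lborel)
      = (\<integral>\<^sup>+t. g (p + t) * indicator {p..p + s} (p + t) \<partial>lborel)"
    by (rule nn_integral_lborel_translation[symmetric]) measurable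
  also have "\<dots> = (\<integral>\<^sup>+t\<in>{0..s}. g t \<partial>lborel)"
    by (auto intro!: nn_integral_cong simp: indicator_def periodic)
  also have "\<dots> = (\<integral>\<^sup>+t\<in>{0..<s}. g t \<partial>lborel)"
    using AE_lborel_singleton[of s]
    by (intro nn_integral_cong_AE) (auto elim!: eventually_mono simp: indicator_def)
  also have "(\<integral>\<^sup>+t\<in>{s..<p}. g t \<partial>lborel) + \<dots> = (\<integral>\<^sup>+t\<in>{s..<p} \<union> {0..<s}. g t \<partial>lborel)"
    by (rule nn_integral_disjoint_pair[symmetric]) auto
  also have "\<dots> = (\<integral>\<^sup>+t\<in>{0..p}. g t \<partial>lborel)"
    using AE_lborel_singleton[of p] s
    by (intro nn_integral_cong_AE) (auto elim!: eventually_mono simp: indicator_def)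
  finally show ?thesis .
qed

definition circle_mean :: "(complex \<Rightarrow> ennreal) \<Rightarrow> complex \<Rightarrow> real \<Rightarrow> ennreal" where
  "circle_mean u a r =
     (\<integral>\<^sup>+t\<in>{0..2*pi}. u (a + complex_of_real r * cis t) \<partial>lborel) / ennreal (2*pi)"

lemma borel_measurable_cis [measurable]: "cis \<in> borel_measurable borel"
  by (intro borel_measurable_continuous_onI continuous_intros)

lemma borel_measurable_circle_mean [measurable]:
  assumes [measurable]: "u \<in> borel_measurable borel"
    "a \<in> borel_measurable M" "r \<in> borel_measurable M"
  shows "(\<lambda>x. circle_mean u (a x) (r x)) \<in> borel_measurable M"
  unfolding circle_mean_def by measurable

lemma circle_mean_radius_0 [simp]: "circle_mean u a 0 = u a"
  by (simp add: circle_mean_def nn_integral_cmult_indicator ennreal_mult_divide_eq)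

lemma circle_mean_cong:
  assumes "0 \<le> r" "\<And>z. cmod (z - a) = r \<Longrightarrow> u z = v z"
  shows "circle_mean u a r = circle_mean v a r"
  using assms unfolding circle_mean_def
  by (intro arg_cong[where f = "\<lambda>x. x / _"] nn_integral_cong) (simp add: norm_mult)

lemma nn_integral_radial_eq_circle_mean:
  fixes g :: "complex \<Rightarrow> ennreal" and \<phi> :: "real \<Rightarrow> ennreal"
  assumes [measurable]: "g \<in> borel_measurable borel" "\<phi> \<in> borel_measurable borel"
  shows "(\<integral>\<^sup>+z. \<phi> (cmod z) * g z \<partial>lborel) = (\<integral>\<^sup>+z. \<phi> (cmod z) * circle_mean g 0 (cmod z) \<partial>lborel)"
proof -
  define I where "I = (\<integral>\<^sup>+z. \<phi> (cmod z) * g z \<partial>lborel)"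
  have rotate: "(\<integral>\<^sup>+z. \<phi> (cmod z) * g (cis t * z) \<partial>lborel) = I" for t
    using nn_integral_lborel_orthogonal_transformation
      [OF orthogonal_transformation_mult_unit, of "cis t" "\<lambda>z. \<phi> (cmod z) * g z"]
    by (simp add: I_def norm_mult)
  have angle: "(\<integral>\<^sup>+t\<in>{0..2*pi}. g (cis t * z) \<partial>lborel)
      = (\<integral>\<^sup>+t\<in>{0..2*pi}. g (of_real (cmod z) * cis t) \<partial>lborel)" for z
  proof -
    have "z = of_real (cmod z) * cis (Arg2pi z)"
      using Arg2pi[of z] by (simp add: cis_conv_exp is_Arg_def)
    then have polar: "cis t * z = of_real (cmod z) * (cis (Arg2pi z) * cis t)" for t
      by (metis mult.assoc mult.commute)
    show ?thesis
      using nn_integral_periodic_shift[of "\<lambda>t. g (of_real (cmod z) * cis t)" "2*pi" "Arg2pi z"]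
        Arg2pi[of z] by (simp add: polar flip: cis_mult)
  qed
  have "I = (\<integral>\<^sup>+t\<in>{0..2*pi}. I \<partial>lborel) / ennreal (2*pi)"
    by (subst nn_integral_cmult_indicator) (auto simp: ennreal_mult_divide_eq)
  also have "(\<integral>\<^sup>+t\<in>{0..2*pi}. I \<partial>lborel)
      = (\<integral>\<^sup>+t. \<integral>\<^sup>+z. \<phi> (cmod z) * (g (cis t * z) * indicator {0..2*pi} t) \<partial>lborel \<partial>lborel)"
    by (simp add: nn_integral_multc rotate flip: mult.assoc)
  also have "\<dots> = (\<integral>\<^sup>+z. \<integral>\<^sup>+t. \<phi> (cmod z) * (g (cis t * z) * indicator {0..2*pi} t) \<partial>lborel \<partial>lborel)"
    by (rule lborel_pair.Fubini') measurable
  also have "\<dots> = (\<integral>\<^sup>+z. \<phi> (cmod z)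
        * (\<integral>\<^sup>+t\<in>{0..2*pi}. g (of_real (cmod z) * cis t) \<partial>lborel) \<partial>lborel)"
    by (simp add: nn_integral_cmult angle)
  also have "\<dots> / ennreal (2*pi) = (\<integral>\<^sup>+z. \<phi> (cmod z) * circle_mean g 0 (cmod z) \<partial>lborel)"
    by (simp add: circle_mean_def ennreal_times_divide nn_integral_divide)
  finally show ?thesis by (simp add: I_def)
qed

lemma nn_integral_mult_circle_mean:
  fixes u W :: "complex \<Rightarrow> ennreal"
  assumes [measurable]: "u \<in> borel_measurable borel" "W \<in> borel_measurable borel"
  shows "(\<integral>\<^sup>+z. W z * circle_mean u z r \<partial>lborel) = (\<integral>\<^sup>+z. circle_mean W z r * u z \<partial>lborel)"
proof -
  define \<zeta> where "\<zeta> t = complex_of_real r * cis t" for t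
  define S where "S = (indicator {0..2*pi} :: real \<Rightarrow> ennreal)"
  have [measurable]: "\<zeta> \<in> borel_measurable borel" "S \<in> borel_measurable borel"
    unfolding \<zeta>_def S_def by measurable
  have antipodal: "(\<integral>\<^sup>+t. W (z - \<zeta> t) * S t \<partial>lborel) = (\<integral>\<^sup>+t. W (z + \<zeta> t) * S t \<partial>lborel)" for z
    using nn_integral_periodic_shift[of "\<lambda>t. W (z + \<zeta> t)" "2*pi" pi]
    by (simp add: \<zeta>_def S_def flip: cis_mult)
  have "(\<integral>\<^sup>+z. W z * circle_mean u z r \<partial>lborel)
      = (\<integral>\<^sup>+z. \<integral>\<^sup>+t. W z * (u (z + \<zeta> t) * S t) \<partial>lborel \<partial>lborel) / ennreal (2*pi)"
    by (simp add: circle_mean_def \<zeta>_def S_def ennreal_times_divide nn_integral_cmult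
        nn_integral_divide)
  also have "(\<integral>\<^sup>+z. \<integral>\<^sup>+t. W z * (u (z + \<zeta> t) * S t) \<partial>lborel \<partial>lborel)
      = (\<integral>\<^sup>+t. \<integral>\<^sup>+z. W z * (u (z + \<zeta> t) * S t) \<partial>lborel \<partial>lborel)"
    by (rule lborel_pair.Fubini') measurable
  also have "\<dots> = (\<integral>\<^sup>+t. \<integral>\<^sup>+z. W (z - \<zeta> t) * (u z * S t) \<partial>lborel \<partial>lborel)"
  proof (rule nn_integral_cong)
    fix t
    show "(\<integral>\<^sup>+z. W z * (u (z + \<zeta> t) * S t) \<partial>lborel) = (\<integral>\<^sup>+z. W (z - \<zeta> t) * (u z * S t) \<partial>lborel)"
      using nn_integral_lborel_translation[of "\<lambda>z. W (z - \<zeta> t) * (u z * S t)" "\<zeta> t"]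
      by (simp add: add.commute)
  qed
  also have "\<dots> = (\<integral>\<^sup>+z. \<integral>\<^sup>+t. W (z - \<zeta> t) * (u z * S t) \<partial>lborel \<partial>lborel)"
    by (rule lborel_pair.Fubini') measurable
  also have "\<dots> = (\<integral>\<^sup>+z. (\<integral>\<^sup>+t. W (z + \<zeta> t) * S t \<partial>lborel) * u z \<partial>lborel)"
  proof (rule nn_integral_cong)
    fix z
    show "(\<integral>\<^sup>+t. W (z - \<zeta> t) * (u z * S t) \<partial>lborel) = (\<integral>\<^sup>+t. W (z + \<zeta> t) * S t \<partial>lborel) * u z"
      by (subst antipodal[symmetric], subst nn_integral_multc[symmetric]) (auto simp: ac_simps)
  qed
  also have "\<dots> / ennreal (2*pi) = (\<integral>\<^sup>+z. circle_mean W z r * u z \<partial>lborel)"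
    by (simp add: circle_mean_def \<zeta>_def S_def ennreal_times_divide nn_integral_divide
        mult.commute[of _ "u _"])
  finally show ?thesis .
qed

subsection \<open>Superharmonic weights\<close>

lemma borel_measurable_lower_semicontinuous:
  fixes \<omega> :: "'a::topological_space \<Rightarrow>
    'b::{complete_linorder, linorder_topology, second_countable_topology}"
  assumes "open S" and lsc: "\<And>z. z \<in> S \<Longrightarrow> \<omega> z \<le> Liminf (at z) \<omega>"
  shows "\<omega> \<in> borel_measurable (restrict_space borel S)"
proof (rule borel_measurableI_greater)
  fix c
  have "open {z \<in> S. c < \<omega> z}"
  proof (subst open_subopen, intro ballI)
    fix z assume z: "z \<in> {z \<in> S. c < \<omega> z}"
    then have "\<forall>\<^sub>F x in at z. c < \<omega> x"
      using lsc[of z] by (intro less_LiminfD) auto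
    moreover have "\<forall>\<^sub>F x in at z. x \<in> S"
      using z \<open>open S\<close> by (auto intro: eventually_at_in_open')
    ultimately have "\<forall>\<^sub>F x in nhds z. x \<in> {z \<in> S. c < \<omega> z}"
      using z by (auto simp: eventually_nhds_conv_at elim: eventually_elim2)
    then show "\<exists>T. open T \<and> z \<in> T \<and> T \<subseteq> {z \<in> S. c < \<omega> z}"
      by (auto simp: eventually_nhds)
  qed
  then show "{z \<in> space (restrict_space borel S). c < \<omega> z} \<in> sets (restrict_space borel S)"
    using \<open>open S\<close> by (auto simp: sets_restrict_space_iff space_restrict_space)
qed

lemma superharmonic_weight_borel_measurable:
  assumes "superharmonic_weight \<omega>"
  shows "\<omega> \<in> borel_measurable (restrict_space borel unit_disk)"
  using assms unfolding superharmonic_weight_def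
  by (intro borel_measurable_lower_semicontinuous) auto

definition zero_extension :: "(complex \<Rightarrow> ennreal) \<Rightarrow> complex \<Rightarrow> ennreal" where
  "zero_extension \<omega> z = \<omega> z * indicator unit_disk z"

lemma superharmonic_weight_zero_extension:
  assumes "superharmonic_weight \<omega>"
  shows "zero_extension \<omega> \<in> borel_measurable borel"
  using superharmonic_weight_borel_measurable[OF assms]
  by (simp add: zero_extension_def[abs_def] borel_measurable_restrict_space_iff_ennreal)

lemma circle_mean_zero_extension_le:
  assumes w: "superharmonic_weight \<omega>" and "0 \<le> r" "cball a r \<subseteq> unit_disk"
  shows "circle_mean (zero_extension \<omega>) a r \<le> \<omega> a"
proof (cases "r = 0")
  case True
  then show ?thesis by (simp add: zero_extension_def indicator_def)
next
  case False
  have "z \<in> unit_disk" if "cmod (z - a) = r" for z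
    using that assms(3) by (intro subsetD[OF assms(3)]) (simp add: dist_norm norm_minus_commute)
  then have "circle_mean (zero_extension \<omega>) a r = circle_mean \<omega> a r"
    using assms(2) by (intro circle_mean_cong) (auto simp: zero_extension_def)
  then show ?thesis
    using assms False by (simp add: superharmonic_weight_def circle_mean_def)
qed

lemma superharmonic_weight_cball_integral_le:
  assumes w: "superharmonic_weight \<omega>" and R: "cball b R \<subseteq> unit_disk"
  shows "(\<integral>\<^sup>+z\<in>cball b R. \<omega> z \<partial>lborel) \<le> \<omega> b * emeasure lborel (cball b R)"
proof -
  define W where "W = zero_extension \<omega>"
  have [measurable]: "W \<in> borel_measurable borel" "cball b R \<in> sets borel"
    unfolding W_def by (simp_all add: superharmonic_weight_zero_extension[OF w])
  have "(\<integral>\<^sup>+z\<in>cball b R. \<omega> z \<partial>lborel) = (\<integral>\<^sup>+z. indicator (cball b R) z * W z \<partial>lborel)"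
    using R by (intro nn_integral_cong) (auto simp: W_def zero_extension_def indicator_def)
  also have "\<dots> = (\<integral>\<^sup>+z. indicator (cball b R) (b + z) * W (b + z) \<partial>lborel)"
    by (rule nn_integral_lborel_translation[symmetric]) measurable
  also have "\<dots> = (\<integral>\<^sup>+z. indicator {..R} (cmod z) * W (b + z) \<partial>lborel)"
    by (intro nn_integral_cong) (auto simp: indicator_def dist_norm)
  also have "\<dots> = (\<integral>\<^sup>+z. indicator {..R} (cmod z) * circle_mean (\<lambda>z. W (b + z)) 0 (cmod z) \<partial>lborel)"
    by (rule nn_integral_radial_eq_circle_mean) measurable
  also have "\<dots> = (\<integral>\<^sup>+z. indicator {..R} (cmod z) * circle_mean W b (cmod z) \<partial>lborel)"
    by (simp add: circle_mean_def)
  also have "\<dots> \<le> (\<integral>\<^sup>+z. \<omega> b * indicator (cball (0::complex) R) z \<partial>lborel)"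
  proof (rule nn_integral_mono)
    fix z :: complex
    have "circle_mean W b (cmod z) \<le> \<omega> b" if "cmod z \<le> R"
      using that R unfolding W_def by (intro circle_mean_zero_extension_le[OF w]) auto
    then show "indicator {..R} (cmod z) * circle_mean W b (cmod z) \<le> \<omega> b * indicator (cball 0 R) z"
      by (auto simp: indicator_def)
  qed
  also have "\<dots> = \<omega> b * emeasure lborel (cball b R)"
    by (cases "0 \<le> R") (simp_all add: nn_integral_cmult_indicator emeasure_cball)
  finally show ?thesis .
qed

lemma superharmonic_weight_cball_integral_finite:
  assumes "superharmonic_weight \<omega>" "cball b R \<subseteq> unit_disk" "\<omega> b < \<infinity>"
  shows "(\<integral>\<^sup>+z\<in>cball b R. \<omega> z \<partial>lborel) < \<infinity>"
  using assms superharmonic_weight_cball_integral_le[OF assms(1,2)]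
    emeasure_lborel_cball_finite[of b R]
  by (auto intro: le_less_trans simp: ennreal_mult_less_top)

lemma superharmonic_weight_cball_subset_closure_finite:
  assumes w: "superharmonic_weight \<omega>" and R: "0 < R" "cball b R \<subseteq> unit_disk" and b: "\<omega> b < \<infinity>"
  shows "cball b R \<subseteq> closure {z \<in> unit_disk. \<omega> z < \<infinity>}"
proof -
  let ?F = "{z \<in> unit_disk. \<omega> z < \<infinity>}"
  have [measurable]: "zero_extension \<omega> \<in> borel_measurable borel" "cball b R \<in> sets borel"
    by (simp_all add: superharmonic_weight_zero_extension[OF w])
  have "(\<integral>\<^sup>+z. zero_extension \<omega> z * indicator (cball b R) z \<partial>lborel)
      = (\<integral>\<^sup>+z\<in>cball b R. \<omega> z \<partial>lborel)"
    using R(2) by (intro nn_integral_cong) (auto simp: zero_extension_def indicator_def)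
  then have "AE z in lborel. zero_extension \<omega> z * indicator (cball b R) z \<noteq> \<infinity>"
    using superharmonic_weight_cball_integral_finite[OF w R(2) b]
    by (intro nn_integral_PInf_AE) auto
  then have "AE z in lborel. z \<in> ball b R \<longrightarrow> z \<in> closure ?F"
    using R(2) closure_subset[of ?F]
    by (auto elim!: eventually_mono simp: zero_extension_def indicator_def subset_iff
        top.not_eq_extremum)
  then have "z \<in> closure ?F" if "z \<in> ball b R" for z
    using that by (intro mem_closed_if_AE_lebesgue_open[of "ball b R" "closure ?F"])
      (auto intro: AE_completion)
  then have "closure (ball b R) \<subseteq> closure ?F"
    by (intro closure_minimal) auto
  then show ?thesis using R(1) by simp
qed

text \<open>The closure of the finiteness set is relatively open in the disk: near each of its points
  there is a disk centred at a point of finiteness, and the weight is integrable on that disk.\<close>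

lemma superharmonic_weight_finite_dense:
  assumes w: "superharmonic_weight \<omega>"
  shows "unit_disk \<subseteq> closure {z \<in> unit_disk. \<omega> z < \<infinity>}"
proof -
  define F where "F = {z \<in> unit_disk. \<omega> z < \<infinity>}"
  have "open (unit_disk \<inter> closure F)"
  proof (subst open_subopen, intro ballI)
    fix z assume z: "z \<in> unit_disk \<inter> closure F"
    define \<delta> where "\<delta> = (1 - cmod z) / 3"
    have \<delta>: "\<delta> > 0" using z by (simp add: \<delta>_def)
    then obtain b where b: "b \<in> F" "dist b z < \<delta>"
      using z closure_approachable by blast
    have sub: "cball b \<delta> \<subseteq> unit_disk"
    proof
      fix x assume "x \<in> cball b \<delta>"
      then have "dist z x < 2 * \<delta>"
        using b(2) dist_triangle[of z x b] by (simp add: dist_commute)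
      then show "x \<in> unit_disk"
        using norm_triangle_sub[of x z] \<delta> by (simp add: \<delta>_def dist_norm norm_minus_commute)
    qed
    then have "cball b \<delta> \<subseteq> closure F"
      using superharmonic_weight_cball_subset_closure_finite[OF w \<delta> sub] b(1) by (simp add: F_def)
    with sub show "\<exists>T. open T \<and> z \<in> T \<and> T \<subseteq> unit_disk \<inter> closure F"
      using b(2) ball_subset_cball[of b \<delta>] by (intro exI[of _ "ball b \<delta>"]) auto
  qed
  moreover have "F \<noteq> {}" "F \<subseteq> unit_disk \<inter> closure F"
    using w closure_subset[of F] by (auto simp: F_def superharmonic_weight_def)
  ultimately have "unit_disk \<inter> closure F = unit_disk"
    using connected_ball[of "0::complex" 1, unfolded connected_clopen, rule_format,
        of "unit_disk \<inter> closure F"]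
    by (auto simp: openin_open_eq closedin_closed_Int)
  then show ?thesis by (auto simp: F_def)
qed

lemma superharmonic_weight_locally_integrable:
  assumes w: "superharmonic_weight \<omega>" and \<rho>: "\<rho> < 1"
  shows "(\<integral>\<^sup>+z\<in>ball 0 \<rho>. \<omega> z \<partial>lborel) < \<infinity>"
proof -
  define \<delta> where "\<delta> = (1 - \<rho>) / 3"
  have "0 \<in> closure {z \<in> unit_disk. \<omega> z < \<infinity>}" "\<delta> > 0"
    using superharmonic_weight_finite_dense[OF w] \<rho> by (auto simp: \<delta>_def)
  then obtain b where b: "\<omega> b < \<infinity>" "cmod b < \<delta>"
    by (force simp: closure_approachable)
  have "cball b (\<rho> + \<delta>) \<subseteq> unit_disk"
  proof
    fix z assume "z \<in> cball b (\<rho> + \<delta>)"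
    then show "z \<in> unit_disk"
      using norm_triangle_sub[of z b] b(2) \<rho>
      by (simp add: \<delta>_def dist_norm norm_minus_commute field_simps)
  qed
  then have "(\<integral>\<^sup>+z\<in>cball b (\<rho> + \<delta>). \<omega> z \<partial>lborel) < \<infinity>"
    using w b(1) by (intro superharmonic_weight_cball_integral_finite)
  moreover have "ball 0 \<rho> \<subseteq> cball b (\<rho> + \<delta>)"
  proof
    fix z :: complex assume "z \<in> ball 0 \<rho>"
    then show "z \<in> cball b (\<rho> + \<delta>)"
      using norm_triangle_ineq4[of b z] b(2) by (simp add: dist_norm)
  qed
  then have "(\<integral>\<^sup>+z\<in>ball 0 \<rho>. \<omega> z \<partial>lborel) \<le> (\<integral>\<^sup>+z\<in>cball b (\<rho> + \<delta>). \<omega> z \<partial>lborel)"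
    by (intro nn_integral_mono mult_left_mono) (auto simp: indicator_def)
  ultimately show ?thesis by (rule le_less_trans[rotated])
qed

subsection \<open>Dirichlet spaces\<close>

definition weighted_area :: "(complex \<Rightarrow> ennreal) \<Rightarrow> real \<Rightarrow> complex measure" where
  "weighted_area \<omega> \<rho> = density (restrict_space lborel (ball 0 \<rho>)) \<omega>"

lemma space_weighted_area [simp]: "space (weighted_area \<omega> \<rho>) = ball 0 \<rho>"
  by (simp add: weighted_area_def space_restrict_space)

lemma sets_weighted_area [measurable_cong, simp]:
  "sets (weighted_area \<omega> \<rho>) = sets (restrict_space borel (ball 0 \<rho>))"
  by (simp add: weighted_area_def sets_restrict_space)

lemma borel_measurable_weighted_area:
  assumes "continuous_on (ball 0 \<rho>) g"
  shows "g \<in> borel_measurable (weighted_area \<omega> \<rho>)"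
  using borel_measurable_continuous_on_restrict[OF assms] by (simp cong: measurable_cong_sets)

lemma nn_integral_weighted_area:
  assumes w: "superharmonic_weight \<omega>" and "\<rho> \<le> 1" and g: "g \<in> borel_measurable (weighted_area \<omega> \<rho>)"
  shows "(\<integral>\<^sup>+z. g z \<partial>weighted_area \<omega> \<rho>) = (\<integral>\<^sup>+z\<in>ball 0 \<rho>. g z * \<omega> z \<partial>lborel)"
proof -
  have "\<omega> \<in> borel_measurable (restrict_space borel (ball 0 \<rho>))"
    by (rule measurable_restrict_mono[OF superharmonic_weight_borel_measurable[OF w]])
      (use \<open>\<rho> \<le> 1\<close> in auto)
  moreover have "g \<in> borel_measurable (restrict_space borel (ball 0 \<rho>))"
    using g by (simp cong: measurable_cong_sets)
  ultimately show ?thesis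
    unfolding weighted_area_def
    by (subst nn_integral_density)
      (auto simp: nn_integral_restrict_space mult.commute sets_restrict_space
        cong: measurable_cong_sets)
qed

lemma finite_measure_weighted_area:
  assumes w: "superharmonic_weight \<omega>" and \<rho>: "\<rho> < 1"
  shows "finite_measure (weighted_area \<omega> \<rho>)"
proof (rule finite_measureI)
  have "emeasure (weighted_area \<omega> \<rho>) (space (weighted_area \<omega> \<rho>)) = (\<integral>\<^sup>+z. 1 \<partial>weighted_area \<omega> \<rho>)"
    by simp
  also have "\<dots> = (\<integral>\<^sup>+z\<in>ball 0 \<rho>. \<omega> z \<partial>lborel)"
    using \<rho> by (subst nn_integral_weighted_area[OF w]) auto
  finally show "emeasure (weighted_area \<omega> \<rho>) (space (weighted_area \<omega> \<rho>)) \<noteq> \<infinity>"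
    using superharmonic_weight_locally_integrable[OF assms] by simp
qed

definition energy :: "(complex \<Rightarrow> ennreal) \<Rightarrow> (complex \<Rightarrow> complex) \<Rightarrow> real" where
  "energy \<omega> f = (\<integral>z. (cmod (deriv f z))\<^sup>2 \<partial>weighted_area \<omega> 1)"

definition dirichlet_space :: "(complex \<Rightarrow> ennreal) \<Rightarrow> (complex \<Rightarrow> complex) set" where
  "dirichlet_space \<omega> =
     {f. f holomorphic_on unit_disk \<and> integrable (weighted_area \<omega> 1) (\<lambda>z. (cmod (deriv f z))\<^sup>2)}"

lemma dirichlet_space_holomorphic: "f \<in> dirichlet_space \<omega> \<Longrightarrow> f holomorphic_on unit_disk"
  by (simp add: dirichlet_space_def)

lemma energy_nonneg: "0 \<le> energy \<omega> f"
  by (simp add: energy_def)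

lemma continuous_on_deriv_holomorphic:
  assumes "f holomorphic_on ball a r"
  shows "continuous_on (ball a r) (deriv f)"
  using assms by (intro holomorphic_on_imp_continuous_on holomorphic_deriv) auto

lemma energy_zero [simp]: "energy \<omega> (\<lambda>_. 0) = 0"
  by (simp add: energy_def)

lemma borel_measurable_deriv:
  assumes "f holomorphic_on unit_disk"
  shows "deriv f \<in> borel_measurable (weighted_area \<omega> 1)"
  using assms by (intro borel_measurable_weighted_area continuous_on_deriv_holomorphic)

lemma dirichlet_space_iff_nn_integral:
  assumes "f holomorphic_on unit_disk"
  shows "f \<in> dirichlet_space \<omega>
    \<longleftrightarrow> (\<integral>\<^sup>+z. ennreal ((cmod (deriv f z))\<^sup>2) \<partial>weighted_area \<omega> 1) < \<infinity>"
  using assms borel_measurable_deriv[OF assms]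
  by (simp add: dirichlet_space_def integrable_iff_bounded)

lemma nn_integral_deriv_eq_energy:
  assumes "f \<in> dirichlet_space \<omega>"
  shows "(\<integral>\<^sup>+z. ennreal ((cmod (deriv f z))\<^sup>2) \<partial>weighted_area \<omega> 1) = ennreal (energy \<omega> f)"
  using assms unfolding energy_def dirichlet_space_def by (intro nn_integral_eq_integral) auto

lemma dirichlet_integral_eq_nn_integral:
  assumes w: "superharmonic_weight \<omega>" and f: "f holomorphic_on unit_disk"
  shows "dirichlet_integral \<omega> f
    = (\<integral>\<^sup>+z. ennreal ((cmod (deriv f z))\<^sup>2) \<partial>weighted_area \<omega> 1) / ennreal pi"
  using borel_measurable_deriv[OF f] unfolding dirichlet_integral_def
  by (subst nn_integral_weighted_area[OF w]) auto

lemma dirichlet_integral_eq_energy: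
  assumes "superharmonic_weight \<omega>" "f \<in> dirichlet_space \<omega>"
  shows "dirichlet_integral \<omega> f = ennreal (energy \<omega> f / pi)"
  using assms energy_nonneg[of \<omega> f]
  by (simp add: dirichlet_integral_eq_nn_integral dirichlet_space_holomorphic
      nn_integral_deriv_eq_energy divide_ennreal)

lemma in_D_iff_dirichlet_space:
  assumes "superharmonic_weight \<omega>"
  shows "in_D \<omega> f \<longleftrightarrow> f \<in> dirichlet_space \<omega>"
proof (cases "f holomorphic_on unit_disk")
  case True
  then show ?thesis
    using assms by (auto simp: in_D_def dirichlet_integral_eq_nn_integral
        dirichlet_space_iff_nn_integral divide_ennreal_def ennreal_mult_less_top inverse_ennreal)
qed (auto simp: in_D_def dirichlet_space_def)

lemma deriv_cong_on_open:
  assumes "open A" "z \<in> A" "\<And>w. w \<in> A \<Longrightarrow> f w = g w"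
  shows "deriv f z = deriv g z"
  using assms by (intro deriv_cong_ev) (auto intro: eventually_mono[OF eventually_nhds_in_open])

lemma energy_cong:
  assumes "\<And>z. z \<in> unit_disk \<Longrightarrow> f z = g z"
  shows "energy \<omega> f = energy \<omega> g"
  unfolding energy_def using deriv_cong_on_open[of unit_disk _ f g] assms
  by (intro Bochner_Integration.integral_cong) auto

lemma dirichlet_space_cong:
  assumes "\<And>z. z \<in> unit_disk \<Longrightarrow> f z = g z"
  shows "f \<in> dirichlet_space \<omega> \<longleftrightarrow> g \<in> dirichlet_space \<omega>"
proof -
  have "f holomorphic_on unit_disk \<longleftrightarrow> g holomorphic_on unit_disk"
    using assms by (intro holomorphic_cong) auto
  moreover have "integrable (weighted_area \<omega> 1) (\<lambda>z. (cmod (deriv f z))\<^sup>2)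
      \<longleftrightarrow> integrable (weighted_area \<omega> 1) (\<lambda>z. (cmod (deriv g z))\<^sup>2)"
    using deriv_cong_on_open[of unit_disk _ f g] assms
    by (intro Bochner_Integration.integrable_cong) auto
  ultimately show ?thesis by (simp add: dirichlet_space_def)
qed

lemma deriv_lincomb:
  assumes "f holomorphic_on unit_disk" "g holomorphic_on unit_disk" "z \<in> unit_disk"
  shows "deriv (\<lambda>z. a * f z + b * g z) z = a * deriv f z + b * deriv g z"
  using holomorphic_derivI[OF assms(1) _ assms(3)] holomorphic_derivI[OF assms(2) _ assms(3)]
  by (intro DERIV_imp_deriv) (auto intro!: derivative_eq_intros)

lemma
  assumes "f holomorphic_on unit_disk"
  shows energy_add_const: "energy \<omega> (\<lambda>z. c + f z) = energy \<omega> f"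
    and dirichlet_space_add_const_iff: "(\<lambda>z. c + f z) \<in> dirichlet_space \<omega> \<longleftrightarrow> f \<in> dirichlet_space \<omega>"
proof -
  have deriv: "deriv (\<lambda>z. c + f z) z = deriv f z" if "z \<in> unit_disk" for z
    using deriv_lincomb[of "\<lambda>_. 1" f z c 1] assms that by simp
  then show "energy \<omega> (\<lambda>z. c + f z) = energy \<omega> f"
    unfolding energy_def by (intro Bochner_Integration.integral_cong) auto
  have "integrable (weighted_area \<omega> 1) (\<lambda>z. (cmod (deriv (\<lambda>z. c + f z) z))\<^sup>2)
      \<longleftrightarrow> integrable (weighted_area \<omega> 1) (\<lambda>z. (cmod (deriv f z))\<^sup>2)"
    using deriv by (intro Bochner_Integration.integrable_cong) auto
  then show "(\<lambda>z. c + f z) \<in> dirichlet_space \<omega> \<longleftrightarrow> f \<in> dirichlet_space \<omega>"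
    using assms by (auto simp: dirichlet_space_def intro!: holomorphic_intros)
qed

lemma integrable_square_norm_add:
  fixes f g :: "'a \<Rightarrow> 'b::{real_normed_vector, second_countable_topology}"
  assumes [measurable]: "f \<in> borel_measurable M" "g \<in> borel_measurable M"
    and "integrable M (\<lambda>x. (norm (f x))\<^sup>2)" "integrable M (\<lambda>x. (norm (g x))\<^sup>2)"
  shows "integrable M (\<lambda>x. (norm (f x + g x))\<^sup>2)"
proof (rule Bochner_Integration.integrable_bound)
  show "integrable M (\<lambda>x. 2 * (norm (f x))\<^sup>2 + 2 * (norm (g x))\<^sup>2)"
    using assms by simp
  have "(norm (f x + g x))\<^sup>2 \<le> 2 * (norm (f x))\<^sup>2 + 2 * (norm (g x))\<^sup>2" for x
    using power_mono[OF norm_triangle_ineq[of "f x" "g x"] norm_ge_zero, of 2]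
      sum_squares_bound[of "norm (f x)" "norm (g x)"]
    by (simp add: power2_sum)
  then show "AE x in M. norm ((norm (f x + g x))\<^sup>2)
        \<le> norm (2 * (norm (f x))\<^sup>2 + 2 * (norm (g x))\<^sup>2)"
    by (intro AE_I2) simp
qed measurable

lemma dirichlet_space_lincomb:
  assumes f: "f \<in> dirichlet_space \<omega>" and g: "g \<in> dirichlet_space \<omega>"
  shows "(\<lambda>z. a * f z + b * g z) \<in> dirichlet_space \<omega>"
proof -
  note hol = dirichlet_space_holomorphic[OF f] dirichlet_space_holomorphic[OF g]
  have [measurable]: "deriv f \<in> borel_measurable (weighted_area \<omega> 1)"
    "deriv g \<in> borel_measurable (weighted_area \<omega> 1)"
    by (intro borel_measurable_deriv hol)+
  have "integrable (weighted_area \<omega> 1) (\<lambda>z. (cmod (a * deriv f z + b * deriv g z))\<^sup>2)"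
    using f g
    by (intro integrable_square_norm_add)
      (auto simp: dirichlet_space_def norm_mult power_mult_distrib)
  also have "?this \<longleftrightarrow> integrable (weighted_area \<omega> 1)
      (\<lambda>z. (cmod (deriv (\<lambda>z. a * f z + b * g z) z))\<^sup>2)"
    by (intro Bochner_Integration.integrable_cong) (auto simp: deriv_lincomb[OF hol])
  finally show ?thesis
    using hol by (auto simp: dirichlet_space_def intro!: holomorphic_intros)
qed

lemma energy_cmult:
  assumes "f holomorphic_on unit_disk"
  shows "energy \<omega> (\<lambda>z. c * f z) = (cmod c)\<^sup>2 * energy \<omega> f"
  unfolding energy_def integral_mult_right_zero[symmetric]
  using deriv_lincomb[OF assms assms, of _ c 0]
  by (intro Bochner_Integration.integral_cong) (auto simp: norm_mult power_mult_distrib)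

lemma energy_real_lincomb:
  assumes f: "f \<in> dirichlet_space \<omega>" and g: "g \<in> dirichlet_space \<omega>"
  shows "energy \<omega> (\<lambda>z. of_real a * f z + of_real b * g z) = a\<^sup>2 * energy \<omega> f + b\<^sup>2 * energy \<omega> g
    + a * b * (energy \<omega> (\<lambda>z. f z + g z) - energy \<omega> f - energy \<omega> g)"
proof -
  note hol = dirichlet_space_holomorphic[OF f] dirichlet_space_holomorphic[OF g]
  have sum: "(\<lambda>z. f z + g z) \<in> dirichlet_space \<omega>"
    using dirichlet_space_lincomb[OF f g, of 1 1] by simp
  have polarization: "(cmod (of_real a * x + of_real b * y))\<^sup>2 = a\<^sup>2 * (cmod x)\<^sup>2 + b\<^sup>2 * (cmod y)\<^sup>2
      + a * b * ((cmod (x + y))\<^sup>2 - (cmod x)\<^sup>2 - (cmod y)\<^sup>2)" for x y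
    by (simp add: cmod_power2) (simp add: power2_eq_square algebra_simps)
  have "energy \<omega> (\<lambda>z. of_real a * f z + of_real b * g z)
      = (\<integral>z. a\<^sup>2 * (cmod (deriv f z))\<^sup>2 + b\<^sup>2 * (cmod (deriv g z))\<^sup>2
        + a * b * ((cmod (deriv (\<lambda>z. f z + g z) z))\<^sup>2 - (cmod (deriv f z))\<^sup>2 - (cmod (deriv g z))\<^sup>2)
          \<partial>weighted_area \<omega> 1)"
    unfolding energy_def using deriv_lincomb[OF hol, of _ 1 1]
    by (intro Bochner_Integration.integral_cong) (auto simp: deriv_lincomb[OF hol] polarization)
  also have "\<dots> = a\<^sup>2 * energy \<omega> f + b\<^sup>2 * energy \<omega> g
      + a * b * (energy \<omega> (\<lambda>z. f z + g z) - energy \<omega> f - energy \<omega> g)"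
    using f g sum by (simp add: dirichlet_space_def energy_def)
  finally show ?thesis .
qed

lemma energy_parallelogram:
  assumes "f \<in> dirichlet_space \<omega>" "g \<in> dirichlet_space \<omega>"
  shows "energy \<omega> (\<lambda>z. f z - g z) + energy \<omega> (\<lambda>z. f z + g z) = 2 * energy \<omega> f + 2 * energy \<omega> g"
  using energy_real_lincomb[OF assms, of 1 "-1"] by simp

subsection \<open>Concavity of the shift\<close>

lemma has_integral_circle_cauchy_coeff:
  assumes g: "g holomorphic_on cball a r" and r: "0 < r"
  shows "((\<lambda>t. g (a + of_real r * cis t) / (of_real r * cis t) ^ n)
    has_integral of_real (2 * pi) * ((deriv ^^ n) g a / fact n)) {0..2*pi}"
proof -
  have "((\<lambda>u. g u / (u - a) ^ Suc n) has_contour_integral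
      of_real (2 * pi) * \<i> / fact n * (deriv ^^ n) g a) (circlepath a r)"
    using r by (intro Cauchy_has_contour_integral_higher_derivative_circlepath
        holomorphic_on_imp_continuous_on g holomorphic_on_subset[OF g]) auto
  then have "((\<lambda>t. g (a + of_real r * cis t) / (of_real r * cis t) ^ Suc n * r * \<i> * cis t)
      has_integral of_real (2 * pi) * \<i> / fact n * (deriv ^^ n) g a) {0..2*pi}"
    unfolding circlepath_def by (subst (asm) has_contour_integral_part_circlepath_iff) auto
  then have "((\<lambda>t. - \<i> * (g (a + of_real r * cis t) / (of_real r * cis t) ^ Suc n * r * \<i> * cis t))
      has_integral - \<i> * (of_real (2 * pi) * \<i> / fact n * (deriv ^^ n) g a)) {0..2*pi}"
    by (rule has_integral_mult_right)
  moreover have "- \<i> * (g (a + of_real r * cis t) / (of_real r * cis t) ^ Suc n * r * \<i> * cis t)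
      = g (a + of_real r * cis t) / (of_real r * cis t) ^ n" for t
    using r by (simp add: field_simps)
  moreover have "- \<i> * (of_real (2 * pi) * \<i> / fact n * (deriv ^^ n) g a)
      = of_real (2 * pi) * ((deriv ^^ n) g a / fact n)"
    by (simp add: field_simps)
  ultimately show ?thesis by (simp only:)
qed

lemma has_integral_circle_affine_pairing:
  assumes h: "h holomorphic_on cball a r" and r: "0 < r"
  shows "((\<lambda>t. cnj (b + c * (of_real r * cis t)) * h (a + of_real r * cis t)) has_integral
    of_real (2 * pi) * (cnj b * h a + cnj c * of_real (r\<^sup>2) * deriv h a)) {0..2*pi}"
proof -
  define \<zeta> where "\<zeta> t = of_real r * cis t" for t
  have "\<zeta> t \<noteq> 0" "cmod (\<zeta> t) = r" for t
    using r by (auto simp: \<zeta>_def norm_mult)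
  then have "cnj (\<zeta> t) = of_real (r\<^sup>2) / \<zeta> t" for t
    using complex_norm_square[of "\<zeta> t"] by (simp add: field_simps)
  then have "cnj (b + c * \<zeta> t) * h (a + \<zeta> t) = cnj b * (h (a + \<zeta> t) / \<zeta> t ^ 0)
      + cnj c * of_real (r\<^sup>2) * (h (a + \<zeta> t) / \<zeta> t ^ 1)" for t
    by (simp add: algebra_simps)
  moreover have "((\<lambda>t. cnj b * (h (a + \<zeta> t) / \<zeta> t ^ 0)
      + cnj c * of_real (r\<^sup>2) * (h (a + \<zeta> t) / \<zeta> t ^ 1)) has_integral
      cnj b * (of_real (2 * pi) * ((deriv ^^ 0) h a / fact 0))
      + cnj c * of_real (r\<^sup>2) * (of_real (2 * pi) * ((deriv ^^ 1) h a / fact 1))) {0..2*pi}"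
    unfolding \<zeta>_def
    by (intro has_integral_add has_integral_mult_right has_integral_circle_cauchy_coeff[OF h r])
  ultimately show ?thesis by (simp add: \<zeta>_def algebra_simps)
qed

lemma holomorphic_first_order_Taylor:
  assumes g: "g holomorphic_on S" and S: "open S" "cball a r \<subseteq> S"
    and bound: "\<And>z. z \<in> cball a r \<Longrightarrow> cmod ((deriv ^^ 2) g z) \<le> B" and z: "z \<in> cball a r"
  shows "cmod (g z - (g a + deriv g a * (z - a))) \<le> B * (cmod (z - a))\<^sup>2"
proof -
  have "cmod ((deriv ^^ 0) g z - (\<Sum>i\<le>1. (deriv ^^ i) g a * (z - a) ^ i / fact i))
      \<le> B * cmod (z - a) ^ Suc 1 / fact 1"
  proof (rule complex_Taylor[where S = "cball a r"])
    fix i w assume "w \<in> cball a r"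
    then show "((deriv ^^ i) g has_field_derivative (deriv ^^ Suc i) g w) (at w within cball a r)"
      using S(2)
      by (intro has_field_derivative_at_within
          [OF has_field_derivative_higher_deriv[OF g S(1)]]) auto
  next
    show "a \<in> cball a r"
      using z by (auto intro: order_trans[OF zero_le_dist])
  qed (use bound z in \<open>simp_all add: numeral_2_eq_2\<close>)
  then show ?thesis by (simp add: power2_eq_square)
qed

lemma has_integral_circle_Re_affine_pairing:
  assumes h: "h holomorphic_on cball a r" and r: "0 < r"
  shows "((\<lambda>t. Re (cnj (h a + deriv h a * (of_real r * cis t)) * h (a + of_real r * cis t)))
    has_integral 2 * pi * ((cmod (h a))\<^sup>2 + r\<^sup>2 * (cmod (deriv h a))\<^sup>2)) {0..2*pi}"
proof -
  have mean_value: "Re (of_real (2 * pi)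
        * (cnj (h a) * h a + cnj (deriv h a) * of_real (r\<^sup>2) * deriv h a))
      = 2 * pi * ((cmod (h a))\<^sup>2 + r\<^sup>2 * (cmod (deriv h a))\<^sup>2)"
    unfolding cmod_power2 by (simp add: power2_eq_square algebra_simps)
  show ?thesis
    using has_integral_linear[OF has_integral_circle_affine_pairing[OF h r] bounded_linear_Re]
    unfolding o_def mean_value[symmetric] .
qed

lemma has_integral_circle_cmod_square_affine:
  assumes r: "0 < r"
  shows "((\<lambda>t. (cmod (b + c * (of_real r * cis t)))\<^sup>2)
    has_integral 2 * pi * ((cmod b)\<^sup>2 + r\<^sup>2 * (cmod c)\<^sup>2)) {0..2*pi}"
proof -
  have deriv: "deriv (\<lambda>z. b + c * z) 0 = c"
    by (auto intro!: DERIV_imp_deriv derivative_eq_intros)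
  have Re_cnj: "Re (cnj w * w) = (cmod w)\<^sup>2" for w
    unfolding cmod_power2 by (simp add: power2_eq_square)
  have "(\<lambda>z. b + c * z) holomorphic_on cball 0 r"
    by (intro holomorphic_intros)
  from has_integral_circle_Re_affine_pairing[OF this r] show ?thesis
    by (simp only: deriv mult_zero_right add_0_left add_0_right Re_cnj)
qed

text \<open>On the circle, the first-order Taylor polynomial is the orthogonal projection of \<open>g\<close> onto
  the affine functions, so the error term is the mean of the square of the remainder.\<close>

lemma has_integral_circle_cmod_square:
  assumes g: "g holomorphic_on S" and S: "open S" "cball a r \<subseteq> S" and r: "0 < r"
    and bound: "\<And>z. z \<in> cball a r \<Longrightarrow> cmod ((deriv ^^ 2) g z) \<le> B"
  obtains e where "0 \<le> e" "e \<le> B\<^sup>2 * r ^ 4"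
    "((\<lambda>t. (cmod (g (a + of_real r * cis t)))\<^sup>2)
      has_integral 2 * pi * ((cmod (g a))\<^sup>2 + r\<^sup>2 * (cmod (deriv g a))\<^sup>2 + e)) {0..2*pi}"
proof -
  define m where "m = (cmod (g a))\<^sup>2 + r\<^sup>2 * (cmod (deriv g a))\<^sup>2"
  define \<zeta> where "\<zeta> t = of_real r * cis t" for t
  define P where "P t = g a + deriv g a * \<zeta> t" for t
  define R where "R t = (cmod (g (a + \<zeta> t) - P t))\<^sup>2" for t
  have \<zeta>: "cmod (\<zeta> t) = r" "a + \<zeta> t \<in> cball a r" for t
    using r by (auto simp: \<zeta>_def norm_mult dist_norm)
  have P_g_int: "((\<lambda>t. Re (cnj (P t) * g (a + \<zeta> t))) has_integral 2 * pi * m) {0..2*pi}"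
    using has_integral_circle_Re_affine_pairing[OF holomorphic_on_subset[OF g S(2)] r]
    by (simp add: P_def m_def \<zeta>_def)
  have P_int: "((\<lambda>t. (cmod (P t))\<^sup>2) has_integral 2 * pi * m) {0..2*pi}"
    unfolding P_def m_def \<zeta>_def by (rule has_integral_circle_cmod_square_affine[OF r])
  have "continuous_on {0..2*pi} R"
    unfolding R_def P_def \<zeta>_def using S(2) \<zeta>(2)
    by (intro continuous_intros continuous_on_compose2[OF holomorphic_on_imp_continuous_on[OF g]])
      (auto simp: \<zeta>_def)
  then obtain I where I: "(R has_integral I) {0..2*pi}"
    by (meson integrable_continuous_interval integrable_on_def)
  define e where "e = I / (2 * pi)"
  have pythagoras: "(cmod (g (a + \<zeta> t)))\<^sup>2
      = 2 * Re (cnj (P t) * g (a + \<zeta> t)) - (cmod (P t))\<^sup>2 + R t" for t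
    unfolding R_def cmod_power2 by (simp add: power2_eq_square algebra_simps)
  have "((\<lambda>t. (cmod (g (a + \<zeta> t)))\<^sup>2) has_integral 2 * (2 * pi * m) - 2 * pi * m + I) {0..2*pi}"
    unfolding pythagoras
    by (intro has_integral_add has_integral_diff has_integral_mult_right P_g_int P_int I)
  also have "2 * (2 * pi * m) - 2 * pi * m + I = 2 * pi * (m + e)"
    by (simp add: e_def field_simps)
  finally have mean: "((\<lambda>t. (cmod (g (a + \<zeta> t)))\<^sup>2) has_integral 2 * pi * (m + e)) {0..2*pi}" .
  have e_nonneg: "0 \<le> e"
    using has_integral_nonneg[OF I] by (simp add: e_def R_def)
  have R_le: "R t \<le> B\<^sup>2 * r ^ 4" for t
  proof -
    have "R t \<le> (B * r\<^sup>2)\<^sup>2"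
      using holomorphic_first_order_Taylor[OF g S bound \<zeta>(2)] \<zeta>(1)
      unfolding R_def P_def by (intro power_mono) simp_all
    then show ?thesis by (simp add: power_mult_distrib flip: power_mult)
  qed
  have "((\<lambda>t. B\<^sup>2 * r ^ 4) has_integral 2 * pi * (B\<^sup>2 * r ^ 4)) {0..2*pi}"
    using has_integral_const_real[of "B\<^sup>2 * r ^ 4" 0 "2*pi"] by simp
  from has_integral_le[OF I this R_le] have "e \<le> B\<^sup>2 * r ^ 4"
    by (simp add: e_def field_simps)
  from e_nonneg this mean show thesis
    unfolding \<zeta>_def m_def by (rule that)
qed

lemma circle_mean_eq_ennreal:
  assumes "((\<lambda>t. u (a + of_real r * cis t)) has_integral 2 * pi * m) {0..2*pi}"
    and nonneg: "\<And>z. cmod (z - a) = \<bar>r\<bar> \<Longrightarrow> 0 \<le> u z"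
  shows "circle_mean (\<lambda>z. ennreal (u z)) a r = ennreal m"
proof -
  have u: "0 \<le> u (a + of_real r * cis t)" for t
    by (intro nonneg) (simp add: norm_mult)
  with assms(1) have "0 \<le> 2 * pi * m"
    by (rule has_integral_nonneg)
  have "(\<integral>\<^sup>+t\<in>{0..2*pi}. ennreal (u (a + of_real r * cis t)) \<partial>lborel)
      = (\<integral>\<^sup>+t. ennreal (indicator {0..2*pi} t * u (a + of_real r * cis t)) \<partial>lborel)"
    by (intro nn_integral_cong) (auto simp: indicator_def)
  also have "\<dots> = ennreal (2 * pi * m)"
    using u assms(1) by (rule nn_integral_has_integral_lebesgue)
  finally show ?thesis
    using \<open>0 \<le> 2 * pi * m\<close> by (simp add: circle_mean_def divide_ennreal zero_le_mult_iff)
qed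

lemma nn_integral_circle_mean_weighted_area_le:
  assumes w: "superharmonic_weight \<omega>" and r: "0 \<le> r" "r + \<rho> \<le> 1"
    and [measurable]: "u \<in> borel_measurable borel" and support: "\<And>z. z \<notin> ball 0 \<rho> \<Longrightarrow> u z = 0"
  shows "(\<integral>\<^sup>+z. circle_mean u z r \<partial>weighted_area \<omega> \<rho>) \<le> (\<integral>\<^sup>+z. u z \<partial>weighted_area \<omega> \<rho>)"
proof -
  have \<rho>: "\<rho> \<le> 1" using r by simp
  have meas: "g \<in> borel_measurable (weighted_area \<omega> \<rho>)" if "g \<in> borel_measurable borel"
    for g :: "complex \<Rightarrow> ennreal"
    using measurable_restrict_space1[OF that] by (simp cong: measurable_cong_sets)
  have "(\<integral>\<^sup>+z. circle_mean u z r \<partial>weighted_area \<omega> \<rho>)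
      = (\<integral>\<^sup>+z\<in>ball 0 \<rho>. circle_mean u z r * \<omega> z \<partial>lborel)"
    by (intro nn_integral_weighted_area[OF w \<rho>] meas) measurable
  also have "\<dots> \<le> (\<integral>\<^sup>+z. zero_extension \<omega> z * circle_mean u z r \<partial>lborel)"
    using \<rho> by (intro nn_integral_mono) (auto simp: zero_extension_def indicator_def mult.commute)
  also have "\<dots> = (\<integral>\<^sup>+z. circle_mean (zero_extension \<omega>) z r * u z \<partial>lborel)"
    by (intro nn_integral_mult_circle_mean superharmonic_weight_zero_extension[OF w]) measurable
  also have "\<dots> \<le> (\<integral>\<^sup>+z\<in>ball 0 \<rho>. u z * \<omega> z \<partial>lborel)"
  proof (rule nn_integral_mono)
    fix z :: complex
    show "circle_mean (zero_extension \<omega>) z r * u z \<le> u z * \<omega> z * indicator (ball 0 \<rho>) z"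
    proof (cases "z \<in> ball 0 \<rho>")
      case True
      have "cball z r \<subseteq> unit_disk"
      proof
        fix x assume "x \<in> cball z r"
        then show "x \<in> unit_disk"
          using True r norm_triangle_sub[of x z] by (simp add: dist_norm norm_minus_commute)
      qed
      then show ?thesis
        using True circle_mean_zero_extension_le[OF w r(1), of z]
        by (simp add: mult.commute[of "u z"] mult_right_mono)
    qed (simp add: support)
  qed
  also have "\<dots> = (\<integral>\<^sup>+z. u z \<partial>weighted_area \<omega> \<rho>)"
    by (intro nn_integral_weighted_area[OF w \<rho>, symmetric] meas) measurable
  finally show ?thesis .
qed

lemma integral_mono_of_nn_integral_mono:
  fixes f g :: "'a \<Rightarrow> real"
  assumes "integrable M f" "integrable M g" "\<And>x. 0 \<le> g x"
    and le: "(\<integral>\<^sup>+x. ennreal (f x) \<partial>M) \<le> (\<integral>\<^sup>+x. ennreal (g x) \<partial>M)"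
  shows "(\<integral>x. f x \<partial>M) \<le> (\<integral>x. g x \<partial>M)"
proof -
  have "(\<integral>x. f x \<partial>M) \<le> enn2real (\<integral>\<^sup>+x. ennreal (f x) \<partial>M)"
    by (simp add: real_lebesgue_integral_def[OF assms(1)])
  also have "\<dots> \<le> enn2real (\<integral>\<^sup>+x. ennreal (g x) \<partial>M)"
    using le assms(2,3) by (intro enn2real_mono) (auto simp: nn_integral_eq_integral)
  also have "\<dots> = (\<integral>x. g x \<partial>M)"
    using assms(2,3) by (simp add: nn_integral_eq_integral integral_nonneg_AE)
  finally show ?thesis .
qed

lemma integral_weighted_area_nonpos_of_circle_mean_ge:
  fixes u \<psi> :: "complex \<Rightarrow> real"
  assumes w: "superharmonic_weight \<omega>" and r: "0 \<le> r" "r + \<rho> \<le> 1" and c: "0 < c"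
    and "u \<in> borel_measurable borel" and u_nonneg: "\<And>z. 0 \<le> u z"
    and support: "\<And>z. z \<notin> ball 0 \<rho> \<Longrightarrow> u z = 0"
    and int: "integrable (weighted_area \<omega> \<rho>) u" "integrable (weighted_area \<omega> \<rho>) \<psi>"
    and mean: "\<And>z. cmod z < \<rho> \<Longrightarrow>
      ennreal (u z + c * \<psi> z) \<le> circle_mean (\<lambda>z. ennreal (u z)) z r"
  shows "(\<integral>z. \<psi> z \<partial>weighted_area \<omega> \<rho>) \<le> 0"
proof -
  have "(\<integral>\<^sup>+z. ennreal (u z + c * \<psi> z) \<partial>weighted_area \<omega> \<rho>)
      \<le> (\<integral>\<^sup>+z. circle_mean (\<lambda>z. ennreal (u z)) z r \<partial>weighted_area \<omega> \<rho>)"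
    using mean by (intro nn_integral_mono) auto
  also have "\<dots> \<le> (\<integral>\<^sup>+z. ennreal (u z) \<partial>weighted_area \<omega> \<rho>)"
    using assms by (intro nn_integral_circle_mean_weighted_area_le[OF w]) auto
  finally have "(\<integral>z. u z + c * \<psi> z \<partial>weighted_area \<omega> \<rho>) \<le> (\<integral>z. u z \<partial>weighted_area \<omega> \<rho>)"
    using int u_nonneg by (intro integral_mono_of_nn_integral_mono) auto
  then show ?thesis
    using int c by (simp add: mult_le_0_iff)
qed

definition strip_minorant :: "real \<Rightarrow> real \<Rightarrow> (complex \<Rightarrow> real) \<Rightarrow> real \<Rightarrow> complex \<Rightarrow> real" where
  "strip_minorant \<rho> K \<Lambda> r z = (if cmod z + r < \<rho> then \<Lambda> z - K * r\<^sup>2 else - K)"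

lemma borel_measurable_strip_minorant:
  assumes [measurable]: "\<Lambda> \<in> borel_measurable (weighted_area \<omega> \<rho>)"
  shows "strip_minorant \<rho> K \<Lambda> r \<in> borel_measurable (weighted_area \<omega> \<rho>)"
proof -
  have [measurable]: "cmod \<in> borel_measurable (weighted_area \<omega> \<rho>)"
    by (intro borel_measurable_weighted_area continuous_intros)
  show ?thesis
    unfolding strip_minorant_def[abs_def] by measurable
qed

lemma abs_strip_minorant_le:
  assumes \<Lambda>: "\<bar>\<Lambda> z\<bar> \<le> K" and r: "0 \<le> r" "r \<le> 1"
  shows "\<bar>strip_minorant \<rho> K \<Lambda> r z\<bar> \<le> 2 * K"
proof -
  have "0 \<le> K" using \<Lambda> by linarith
  then have "0 \<le> K * r\<^sup>2" "K * r\<^sup>2 \<le> K"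
    using r by (auto simp: power_le_one mult_left_le)
  then show ?thesis
    using \<Lambda> unfolding strip_minorant_def by (simp only: abs_le_iff split: if_split) linarith
qed

lemma strip_minorant_LIMSEQ:
  assumes "cmod z < \<rho>" and s: "s \<longlonglongrightarrow> 0"
  shows "(\<lambda>n. strip_minorant \<rho> K \<Lambda> (s n) z) \<longlonglongrightarrow> \<Lambda> z"
proof -
  have "\<forall>\<^sub>F n in sequentially. s n < \<rho> - cmod z"
    using assms by (intro order_tendstoD(2)) auto
  then have "\<forall>\<^sub>F n in sequentially. \<Lambda> z - K * (s n)\<^sup>2 = strip_minorant \<rho> K \<Lambda> (s n) z"
    by eventually_elim (simp add: strip_minorant_def)
  moreover have "(\<lambda>n. \<Lambda> z - K * (s n)\<^sup>2) \<longlonglongrightarrow> \<Lambda> z - K * 0\<^sup>2"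
    by (intro tendsto_intros s)
  ultimately show ?thesis
    using Lim_transform_eventually by fastforce
qed

text \<open>\<open>\<Lambda>\<close> is a quarter of the Laplacian of \<open>u\<close> inside the disk of radius \<open>\<rho>\<close>. The last
  assumption, vanishing of \<open>u\<close> to second order on the boundary, makes the strip where the circle
  of radius \<open>r\<close> leaves this disk contribute at most \<open>K r\<^sup>2\<close> times its mass, which is \<open>o(r\<^sup>2)\<close>.\<close>

lemma integral_laplacian_weighted_area_nonpos:
  fixes u \<Lambda> :: "complex \<Rightarrow> real"
  assumes w: "superharmonic_weight \<omega>" and \<rho>: "0 < \<rho>" "\<rho> < 1"
    and u: "u \<in> borel_measurable borel" and u_nonneg: "\<And>z. 0 \<le> u z"
    and support: "\<And>z. z \<notin> ball 0 \<rho> \<Longrightarrow> u z = 0"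
    and \<Lambda>: "\<Lambda> \<in> borel_measurable (weighted_area \<omega> \<rho>)"
    and \<Lambda>_bound: "\<And>z. cmod z < \<rho> \<Longrightarrow> \<bar>\<Lambda> z\<bar> \<le> K"
    and mean: "\<And>z r. 0 < r \<Longrightarrow> cmod z + r < \<rho> \<Longrightarrow>
      ennreal (u z + r\<^sup>2 * (\<Lambda> z - K * r\<^sup>2)) \<le> circle_mean (\<lambda>z. ennreal (u z)) z r"
    and strip: "\<And>z r. cmod z < \<rho> \<Longrightarrow> \<rho> \<le> cmod z + r \<Longrightarrow> u z \<le> K * r\<^sup>2"
  shows "(\<integral>z. \<Lambda> z \<partial>weighted_area \<omega> \<rho>) \<le> 0"
proof -
  interpret finite_measure "weighted_area \<omega> \<rho>"
    by (rule finite_measure_weighted_area[OF w \<rho>(2)])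
  let ?\<psi> = "strip_minorant \<rho> K \<Lambda>"
  note \<psi> = borel_measurable_strip_minorant[OF \<Lambda>, of K]
  have integral_\<psi>_nonpos: "(\<integral>z. ?\<psi> r z \<partial>weighted_area \<omega> \<rho>) \<le> 0" if r: "0 < r" "r + \<rho> \<le> 1" for r
  proof (rule integral_weighted_area_nonpos_of_circle_mean_ge[OF w _ r(2) _ u u_nonneg support])
    have "u \<in> borel_measurable (weighted_area \<omega> \<rho>)"
      using measurable_restrict_space1[OF u] by (simp cong: measurable_cong_sets)
    then show "integrable (weighted_area \<omega> \<rho>) u"
      using strip[of _ \<rho>] u_nonneg by (intro integrable_const_bound[of _ "K * \<rho>\<^sup>2"]) auto
    show "integrable (weighted_area \<omega> \<rho>) (?\<psi> r)"
      using abs_strip_minorant_le[OF \<Lambda>_bound] r \<rho> \<psi>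
      by (intro integrable_const_bound[of _ "2 * K"]) auto
    fix z assume z: "cmod z < \<rho>"
    show "ennreal (u z + r\<^sup>2 * ?\<psi> r z) \<le> circle_mean (\<lambda>z. ennreal (u z)) z r"
    proof (cases "cmod z + r < \<rho>")
      case True
      then show ?thesis using mean[OF r(1) True] by (simp add: strip_minorant_def)
    next
      case False
      then have "u z + r\<^sup>2 * ?\<psi> r z \<le> 0"
        using strip[of z r] z by (simp add: strip_minorant_def mult.commute)
      then show ?thesis by (simp add: ennreal_neg)
    qed
  qed (use r in auto)
  define s where "s n = (1 - \<rho>) * inverse (real (Suc n))" for n
  have "s n \<le> 1 - \<rho>" for n
    unfolding s_def using \<rho> by (intro mult_left_le) (auto simp: inverse_le_1_iff)
  then have s: "0 < s n" "s n + \<rho> \<le> 1" for n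
    using \<rho> by (auto simp: s_def algebra_simps)
  have s_0: "s \<longlonglongrightarrow> 0"
    unfolding s_def using tendsto_mult_right_zero[OF LIMSEQ_inverse_real_of_nat] .
  have "(\<lambda>n. \<integral>z. ?\<psi> (s n) z \<partial>weighted_area \<omega> \<rho>) \<longlonglongrightarrow> (\<integral>z. \<Lambda> z \<partial>weighted_area \<omega> \<rho>)"
  proof (rule integral_dominated_convergence[where w = "\<lambda>_. 2 * K"])
    show "AE z in weighted_area \<omega> \<rho>. (\<lambda>n. ?\<psi> (s n) z) \<longlonglongrightarrow> \<Lambda> z"
      using strip_minorant_LIMSEQ[OF _ s_0] by (intro AE_I2) auto
    show "AE z in weighted_area \<omega> \<rho>. norm (?\<psi> (s n) z) \<le> 2 * K" for n
      using abs_strip_minorant_le[OF \<Lambda>_bound] s[of n] \<rho>(1) by (intro AE_I2) auto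
  qed (use \<Lambda> \<psi> in auto)
  then show ?thesis
    by (rule LIMSEQ_le_const2) (use integral_\<psi>_nonpos s in blast)
qed

lemma continuous_on_ball_bounded_on_cball:
  fixes f :: "'a::euclidean_space \<Rightarrow> 'b::real_normed_vector"
  assumes "continuous_on (ball a R) f" "r < R"
  obtains M where "\<And>x. x \<in> cball a r \<Longrightarrow> norm (f x) \<le> M"
proof -
  have "bounded (f ` cball a r)"
    using assms
    by (intro compact_imp_bounded compact_continuous_image continuous_on_subset[OF assms(1)]) auto
  then show thesis
    using that by (force simp: bounded_iff)
qed

definition boundary_cutoff :: "real \<Rightarrow> (complex \<Rightarrow> complex) \<Rightarrow> complex \<Rightarrow> real" where
  "boundary_cutoff \<rho> f z = indicator (ball 0 \<rho>) z * ((\<rho>\<^sup>2 - (cmod z)\<^sup>2)\<^sup>2 * (cmod (f z))\<^sup>2)"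

text \<open>A quarter of the Laplacian of \<open>boundary_cutoff \<rho> f\<close> inside the disk of radius \<open>\<rho>\<close>: for
  holomorphic \<open>g\<close>, a quarter of the Laplacian of \<open>|g|\<^sup>2\<close> is \<open>|g'|\<^sup>2\<close>.\<close>

definition boundary_cutoff_laplacian :: "real \<Rightarrow> (complex \<Rightarrow> complex) \<Rightarrow> complex \<Rightarrow> real" where
  "boundary_cutoff_laplacian \<rho> f z = (cmod (deriv (\<lambda>z. z\<^sup>2 * f z) z))\<^sup>2
     - 2 * \<rho>\<^sup>2 * (cmod (deriv (\<lambda>z. z * f z) z))\<^sup>2 + \<rho> ^ 4 * (cmod (deriv f z))\<^sup>2"

lemma boundary_cutoff_eq:
  assumes "cmod z < \<rho>"
  shows "boundary_cutoff \<rho> f z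
    = (cmod (z\<^sup>2 * f z))\<^sup>2 - 2 * \<rho>\<^sup>2 * (cmod (z * f z))\<^sup>2 + \<rho> ^ 4 * (cmod (f z))\<^sup>2"
  using assms unfolding boundary_cutoff_def norm_mult norm_power
  by (simp add: power2_eq_square power4_eq_xxxx algebra_simps)

lemma circle_mean_boundary_cutoff_eq:
  fixes f :: "complex \<Rightarrow> complex" and \<rho> :: real
  defines "M \<equiv> \<lambda>k z. z ^ k * f z"
  assumes r: "0 < r" and z: "cmod z + r < \<rho>"
    and mean: "\<And>k. ((\<lambda>t. (cmod (M k (z + of_real r * cis t)))\<^sup>2)
      has_integral 2 * pi * ((cmod (M k z))\<^sup>2 + r\<^sup>2 * (cmod (deriv (M k) z))\<^sup>2 + e k)) {0..2*pi}"
  shows "circle_mean (\<lambda>z. ennreal (boundary_cutoff \<rho> f z)) z r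
    = ennreal (boundary_cutoff \<rho> f z + r\<^sup>2 * boundary_cutoff_laplacian \<rho> f z
        + (e 2 - 2 * \<rho>\<^sup>2 * e 1 + \<rho> ^ 4 * e 0))"
proof (rule circle_mean_eq_ennreal)
  let ?u = "boundary_cutoff \<rho> f" and ?\<Lambda> = "boundary_cutoff_laplacian \<rho> f"
  have u_eq: "?u x = (cmod (M 2 x))\<^sup>2 - 2 * \<rho>\<^sup>2 * (cmod (M 1 x))\<^sup>2 + \<rho> ^ 4 * (cmod (M 0 x))\<^sup>2"
    if "x \<in> cball z r" for x
  proof -
    have "cmod x < \<rho>"
      using that z norm_triangle_sub[of x z] by (simp add: dist_norm norm_minus_commute)
    then show ?thesis by (simp add: boundary_cutoff_eq M_def)
  qed
  have \<Lambda>_eq: "?\<Lambda> z = (cmod (deriv (M 2) z))\<^sup>2 - 2 * \<rho>\<^sup>2 * (cmod (deriv (M 1) z))\<^sup>2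
      + \<rho> ^ 4 * (cmod (deriv (M 0) z))\<^sup>2"
    by (simp add: boundary_cutoff_laplacian_def M_def)
  have on_circle: "z + of_real r * cis t \<in> cball z r" for t
    using r by (simp add: dist_norm norm_mult)
  have "((\<lambda>t. ?u (z + of_real r * cis t)) has_integral
      2 * pi * ((cmod (M 2 z))\<^sup>2 + r\<^sup>2 * (cmod (deriv (M 2) z))\<^sup>2 + e 2)
      - 2 * \<rho>\<^sup>2 * (2 * pi * ((cmod (M 1 z))\<^sup>2 + r\<^sup>2 * (cmod (deriv (M 1) z))\<^sup>2 + e 1))
      + \<rho> ^ 4 * (2 * pi * ((cmod (M 0 z))\<^sup>2 + r\<^sup>2 * (cmod (deriv (M 0) z))\<^sup>2 + e 0))) {0..2*pi}"
    unfolding u_eq[OF on_circle]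
    by (intro has_integral_add has_integral_diff has_integral_mult_right mean)
  then show "((\<lambda>t. ?u (z + of_real r * cis t)) has_integral
      2 * pi * (?u z + r\<^sup>2 * ?\<Lambda> z + (e 2 - 2 * \<rho>\<^sup>2 * e 1 + \<rho> ^ 4 * e 0))) {0..2*pi}"
    using r by (simp add: u_eq \<Lambda>_eq algebra_simps)
qed (simp add: boundary_cutoff_def)

lemma circle_mean_boundary_cutoff_ge:
  assumes f: "f holomorphic_on unit_disk" and \<rho>: "\<rho> < 1"
  obtains K where "\<And>z r. 0 < r \<Longrightarrow> cmod z + r < \<rho> \<Longrightarrow>
    ennreal (boundary_cutoff \<rho> f z + r\<^sup>2 * (boundary_cutoff_laplacian \<rho> f z - K * r\<^sup>2))
      \<le> circle_mean (\<lambda>z. ennreal (boundary_cutoff \<rho> f z)) z r"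
proof -
  define M where "M k = (\<lambda>z. z ^ k * f z)" for k :: nat
  have M: "M k holomorphic_on unit_disk" for k
    unfolding M_def by (intro holomorphic_intros f)
  have "\<exists>B. \<forall>z\<in>cball 0 \<rho>. cmod ((deriv ^^ 2) (M k) z) \<le> B" for k
    using \<rho> continuous_on_ball_bounded_on_cball
      [OF holomorphic_on_imp_continuous_on[OF holomorphic_higher_deriv[OF M open_ball, of 2 k]]]
    by metis
  then obtain B where B: "\<And>k z. z \<in> cball 0 \<rho> \<Longrightarrow> cmod ((deriv ^^ 2) (M k) z) \<le> B k"
    by metis
  show thesis
  proof
    fix z r assume r: "0 < r" and z: "cmod z + r < \<rho>"
    have near: "x \<in> cball 0 \<rho>" if "x \<in> cball z r" for x
      using that z norm_triangle_sub[of x z] by (simp add: dist_norm norm_minus_commute)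
    have sub: "cball z r \<subseteq> unit_disk"
    proof
      fix x assume "x \<in> cball z r"
      then show "x \<in> unit_disk" using near[of x] \<rho> by simp
    qed
    have "\<exists>e. 0 \<le> e \<and> e \<le> (B k)\<^sup>2 * r ^ 4 \<and> ((\<lambda>t. (cmod (M k (z + of_real r * cis t)))\<^sup>2)
        has_integral
          2 * pi * ((cmod (M k z))\<^sup>2 + r\<^sup>2 * (cmod (deriv (M k) z))\<^sup>2 + e)) {0..2*pi}" for k
      using has_integral_circle_cmod_square[OF M open_ball sub r B[OF near]] by blast
    then obtain e where e: "\<And>k. 0 \<le> e k" "\<And>k. e k \<le> (B k)\<^sup>2 * r ^ 4"
      and mean: "\<And>k. ((\<lambda>t. (cmod (M k (z + of_real r * cis t)))\<^sup>2)
        has_integral 2 * pi * ((cmod (M k z))\<^sup>2 + r\<^sup>2 * (cmod (deriv (M k) z))\<^sup>2 + e k)) {0..2*pi}"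
      by metis
    have "2 * \<rho>\<^sup>2 * e 1 \<le> 2 * \<rho>\<^sup>2 * ((B 1)\<^sup>2 * r ^ 4)" "0 \<le> \<rho> ^ 4 * e 0"
      using e by (auto intro!: mult_left_mono)
    then show "ennreal (boundary_cutoff \<rho> f z
          + r\<^sup>2 * (boundary_cutoff_laplacian \<rho> f z - 2 * \<rho>\<^sup>2 * (B 1)\<^sup>2 * r\<^sup>2))
        \<le> circle_mean (\<lambda>z. ennreal (boundary_cutoff \<rho> f z)) z r"
      unfolding circle_mean_boundary_cutoff_eq[OF r z mean[unfolded M_def]] using e(1)[of 2]
      by (intro ennreal_leI) (simp add: power2_eq_square power4_eq_xxxx algebra_simps)
  qed
qed

lemma boundary_cutoff_strip_le:
  assumes f: "\<And>z. z \<in> cball 0 \<rho> \<Longrightarrow> cmod (f z) \<le> M" and \<rho>: "\<rho> < 1"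
    and z: "cmod z < \<rho>" "\<rho> \<le> cmod z + r"
  shows "boundary_cutoff \<rho> f z \<le> 4 * M\<^sup>2 * r\<^sup>2"
proof -
  have "\<rho>\<^sup>2 - (cmod z)\<^sup>2 = (\<rho> - cmod z) * (\<rho> + cmod z)"
    by (simp add: power2_eq_square algebra_simps)
  also have "\<dots> \<le> r * 2"
    using z \<rho> norm_ge_zero[of z] by (intro mult_mono) linarith+
  finally have "(\<rho>\<^sup>2 - (cmod z)\<^sup>2)\<^sup>2 \<le> (r * 2)\<^sup>2"
    using z by (intro power_mono) (auto intro: power_mono)
  moreover have "(cmod (f z))\<^sup>2 \<le> M\<^sup>2"
    using f z by (intro power_mono) auto
  ultimately have "(\<rho>\<^sup>2 - (cmod z)\<^sup>2)\<^sup>2 * (cmod (f z))\<^sup>2 \<le> (r * 2)\<^sup>2 * M\<^sup>2"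
    by (intro mult_mono) auto
  then show ?thesis
    using z(1) by (simp add: boundary_cutoff_def power_mult_distrib ac_simps)
qed

lemma integral_boundary_cutoff_laplacian_nonpos:
  assumes w: "superharmonic_weight \<omega>" and f: "f holomorphic_on unit_disk" and \<rho>: "0 < \<rho>" "\<rho> < 1"
  shows "(\<integral>z. boundary_cutoff_laplacian \<rho> f z \<partial>weighted_area \<omega> \<rho>) \<le> 0"
proof -
  obtain K_mean where mean: "\<And>z r. 0 < r \<Longrightarrow> cmod z + r < \<rho> \<Longrightarrow>
      ennreal (boundary_cutoff \<rho> f z + r\<^sup>2 * (boundary_cutoff_laplacian \<rho> f z - K_mean * r\<^sup>2))
        \<le> circle_mean (\<lambda>z. ennreal (boundary_cutoff \<rho> f z)) z r"
    using circle_mean_boundary_cutoff_ge[OF f \<rho>(2)] by blast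
  obtain M where M: "\<And>z. z \<in> cball 0 \<rho> \<Longrightarrow> cmod (f z) \<le> M"
    using continuous_on_ball_bounded_on_cball
      [OF holomorphic_on_imp_continuous_on[OF f] \<rho>(2)] by blast
  have cont: "continuous_on unit_disk (boundary_cutoff_laplacian \<rho> f)"
    unfolding boundary_cutoff_laplacian_def
    by (intro continuous_intros continuous_on_deriv_holomorphic holomorphic_intros f)
  obtain K_lap where K_lap: "\<And>z. z \<in> cball 0 \<rho> \<Longrightarrow> \<bar>boundary_cutoff_laplacian \<rho> f z\<bar> \<le> K_lap"
    using continuous_on_ball_bounded_on_cball[OF cont \<rho>(2)] by (metis real_norm_def)
  define K where "K = max (4 * M\<^sup>2) (max K_mean K_lap)"
  show ?thesis
  proof (rule integral_laplacian_weighted_area_nonpos[OF w \<rho>,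
        where u = "boundary_cutoff \<rho> f" and K = K])
    have "continuous_on (ball 0 \<rho>) (\<lambda>z. (\<rho>\<^sup>2 - (cmod z)\<^sup>2)\<^sup>2 * (cmod (f z))\<^sup>2)"
      using \<rho> by (intro continuous_intros
          continuous_on_subset[OF holomorphic_on_imp_continuous_on[OF f]]) auto
    then show "boundary_cutoff \<rho> f \<in> borel_measurable borel"
      using borel_measurable_continuous_on_indicator[of "ball 0 \<rho>"
          "\<lambda>z. (\<rho>\<^sup>2 - (cmod z)\<^sup>2)\<^sup>2 * (cmod (f z))\<^sup>2"]
      by (simp add: boundary_cutoff_def[abs_def])
    show "boundary_cutoff_laplacian \<rho> f \<in> borel_measurable (weighted_area \<omega> \<rho>)"
      using \<rho> by (intro borel_measurable_weighted_area continuous_on_subset[OF cont]) auto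
    show "\<bar>boundary_cutoff_laplacian \<rho> f z\<bar> \<le> K" if "cmod z < \<rho>" for z
      using K_lap[of z] that by (simp add: K_def)
    show "ennreal (boundary_cutoff \<rho> f z + r\<^sup>2 * (boundary_cutoff_laplacian \<rho> f z - K * r\<^sup>2))
        \<le> circle_mean (\<lambda>z. ennreal (boundary_cutoff \<rho> f z)) z r" if "0 < r" "cmod z + r < \<rho>" for z r
    proof -
      have "K_mean * r\<^sup>2 \<le> K * r\<^sup>2"
        by (intro mult_right_mono) (auto simp: K_def)
      then show ?thesis
        by (intro order_trans[OF ennreal_leI mean[OF that]] add_left_mono mult_left_mono) auto
    qed
    show "boundary_cutoff \<rho> f z \<le> K * r\<^sup>2" if "cmod z < \<rho>" "\<rho> \<le> cmod z + r" for z r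
      by (rule order_trans[OF boundary_cutoff_strip_le[OF M \<rho>(2) that]])
        (auto intro: mult_right_mono simp: K_def)
  qed (auto simp: boundary_cutoff_def)
qed

lemma nn_integral_deriv_concave_ball:
  assumes w: "superharmonic_weight \<omega>" and f: "f holomorphic_on unit_disk" and \<rho>: "0 < \<rho>" "\<rho> < 1"
  defines "D \<equiv> \<lambda>g. (\<integral>\<^sup>+z. ennreal ((cmod (deriv g z))\<^sup>2) \<partial>weighted_area \<omega> \<rho>)"
  shows "D (\<lambda>z. z\<^sup>2 * f z) + ennreal (\<rho> ^ 4) * D f \<le> ennreal (2 * \<rho>\<^sup>2) * D (\<lambda>z. z * f z)"
proof -
  interpret finite_measure "weighted_area \<omega> \<rho>"
    by (rule finite_measure_weighted_area[OF w \<rho>(2)])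
  define X where "X g = (\<integral>z. (cmod (deriv g z))\<^sup>2 \<partial>weighted_area \<omega> \<rho>)" for g
  have integrable: "integrable (weighted_area \<omega> \<rho>) (\<lambda>z. (cmod (deriv g z))\<^sup>2)"
    if g: "g holomorphic_on unit_disk" for g
  proof -
    obtain M where "\<And>z. z \<in> cball 0 \<rho> \<Longrightarrow> cmod (deriv g z) \<le> M"
      using continuous_on_ball_bounded_on_cball
        [OF continuous_on_deriv_holomorphic[OF g] \<rho>(2)] by blast
    then have "AE z in weighted_area \<omega> \<rho>. norm ((cmod (deriv g z))\<^sup>2) \<le> M\<^sup>2"
      by (intro AE_I2) (auto intro: power_mono)
    moreover have "deriv g \<in> borel_measurable (weighted_area \<omega> \<rho>)"
      using \<rho>
      by (intro borel_measurable_weighted_area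
          continuous_on_subset[OF continuous_on_deriv_holomorphic[OF g]]) auto
    ultimately show ?thesis
      by (intro integrable_const_bound) auto
  qed
  have D: "D g = ennreal (X g)" if "g holomorphic_on unit_disk" for g
    unfolding D_def X_def by (intro nn_integral_eq_integral integrable that) auto
  have X_nonneg: "0 \<le> X g" for g
    by (simp add: X_def)
  have hol: "(\<lambda>z. z * f z) holomorphic_on unit_disk" "(\<lambda>z. z\<^sup>2 * f z) holomorphic_on unit_disk"
    by (intro holomorphic_intros f)+
  have "X (\<lambda>z. z\<^sup>2 * f z) - 2 * \<rho>\<^sup>2 * X (\<lambda>z. z * f z) + \<rho> ^ 4 * X f
      = (\<integral>z. boundary_cutoff_laplacian \<rho> f z \<partial>weighted_area \<omega> \<rho>)"
    using integrable[OF f] integrable[OF hol(1)] integrable[OF hol(2)]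
    by (simp add: X_def boundary_cutoff_laplacian_def)
  also have "\<dots> \<le> 0"
    by (rule integral_boundary_cutoff_laplacian_nonpos[OF w f \<rho>])
  finally have "X (\<lambda>z. z\<^sup>2 * f z) + \<rho> ^ 4 * X f \<le> 2 * \<rho>\<^sup>2 * X (\<lambda>z. z * f z)"
    by simp
  then show ?thesis
    using X_nonneg \<rho>(1)
    by (simp add: D hol f flip: ennreal_mult ennreal_plus)
qed

lemma nn_integral_weighted_area_LIMSEQ:
  assumes w: "superharmonic_weight \<omega>" and g: "g \<in> borel_measurable (weighted_area \<omega> 1)"
    and \<rho>: "incseq \<rho>" "\<And>n. \<rho> n < 1" "\<rho> \<longlonglongrightarrow> 1"
  shows "(\<lambda>n. \<integral>\<^sup>+z. g z \<partial>weighted_area \<omega> (\<rho> n)) \<longlonglongrightarrow> (\<integral>\<^sup>+z. g z \<partial>weighted_area \<omega> 1)"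
proof -
  have g_restrict: "g \<in> borel_measurable (restrict_space borel unit_disk)"
    using g by (simp cong: measurable_cong_sets)
  have "g \<in> borel_measurable (weighted_area \<omega> (\<rho> n))" for n
    using measurable_restrict_mono[OF g_restrict, of "ball 0 (\<rho> n)"] less_imp_le[OF \<rho>(2), of n]
    by (simp add: subset_ball cong: measurable_cong_sets)
  then have "(\<integral>\<^sup>+z. g z \<partial>weighted_area \<omega> (\<rho> n)) = (\<integral>\<^sup>+z\<in>ball 0 (\<rho> n). g z * \<omega> z \<partial>lborel)" for n
    using \<rho>(2)[of n] by (intro nn_integral_weighted_area[OF w]) auto
  moreover have "(\<lambda>n. \<integral>\<^sup>+z\<in>ball 0 (\<rho> n). g z * \<omega> z \<partial>lborel)
      \<longlonglongrightarrow> (\<integral>\<^sup>+z\<in>unit_disk. g z * \<omega> z \<partial>lborel)"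
  proof (rule nn_integral_LIMSEQ)
    show "incseq (\<lambda>n z. g z * \<omega> z * indicator (ball 0 (\<rho> n)) z)"
      using \<rho>(1) by (fastforce simp: incseq_def le_fun_def indicator_def)
    have "(\<lambda>z. g z * \<omega> z * indicator unit_disk z) \<in> borel_measurable borel"
      using g_restrict superharmonic_weight_borel_measurable[OF w]
      by (simp flip: borel_measurable_restrict_space_iff_ennreal)
    then have "(\<lambda>z. (g z * \<omega> z * indicator unit_disk z) * indicator (ball 0 (\<rho> n)) z)
        \<in> borel_measurable borel" for n
      by (rule borel_measurable_times_ennreal[OF _ borel_measurable_indicator]) simp
    moreover have "(g z * \<omega> z * indicator unit_disk z) * indicator (ball 0 (\<rho> n)) z
        = g z * \<omega> z * indicator (ball 0 (\<rho> n)) z" for n z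
      using \<rho>(2)[of n] by (auto simp: indicator_def)
    ultimately show "(\<lambda>z. g z * \<omega> z * indicator (ball 0 (\<rho> n)) z) \<in> borel_measurable lborel" for n
      by simp
    show "(\<lambda>n. g z * \<omega> z * indicator (ball 0 (\<rho> n)) z) \<longlonglongrightarrow> g z * \<omega> z * indicator unit_disk z" for z
    proof (cases "z \<in> unit_disk")
      case True
      then have "\<forall>\<^sub>F n in sequentially. cmod z < \<rho> n"
        using \<rho>(3) by (intro order_tendstoD(1)) auto
      then show ?thesis
        using True by (intro tendsto_eventually) (auto elim!: eventually_mono)
    next
      case False
      then have "z \<notin> ball 0 (\<rho> n)" for n
        using \<rho>(2)[of n] by auto
      then show ?thesis using False by simp
    qed
  qed
  ultimately show ?thesis
    using g by (simp add: nn_integral_weighted_area[OF w])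
qed

lemma nn_integral_deriv_concave:
  assumes w: "superharmonic_weight \<omega>" and f: "f holomorphic_on unit_disk"
  defines "D \<equiv> \<lambda>g. (\<integral>\<^sup>+z. ennreal ((cmod (deriv g z))\<^sup>2) \<partial>weighted_area \<omega> 1)"
  shows "D (\<lambda>z. z\<^sup>2 * f z) + D f \<le> 2 * D (\<lambda>z. z * f z)"
proof -
  define \<rho> where "\<rho> = (\<lambda>n. 1 - inverse (real (n + 2)))"
  define D' where "D' n g = (\<integral>\<^sup>+z. ennreal ((cmod (deriv g z))\<^sup>2) \<partial>weighted_area \<omega> (\<rho> n))" for n g
  have \<rho>_bounds: "0 < \<rho> n" "\<rho> n < 1" for n
    by (auto simp: \<rho>_def field_simps)
  have \<rho>_incseq: "incseq \<rho>"
    by (auto simp: \<rho>_def incseq_def field_simps)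
  have \<rho>_lim: "\<rho> \<longlonglongrightarrow> 1"
    unfolding \<rho>_def
    using tendsto_diff[OF tendsto_const LIMSEQ_ignore_initial_segment[OF lim_inverse_n, of 2]]
    by fastforce
  have D'_lim: "(\<lambda>n. D' n g) \<longlonglongrightarrow> D g" if "g holomorphic_on unit_disk" for g
    unfolding D'_def D_def using borel_measurable_deriv[OF that, of \<omega>]
    by (intro nn_integral_weighted_area_LIMSEQ[OF w _ \<rho>_incseq \<rho>_bounds(2) \<rho>_lim]) auto
  have hol: "(\<lambda>z. z * f z) holomorphic_on unit_disk" "(\<lambda>z. z\<^sup>2 * f z) holomorphic_on unit_disk"
    by (intro holomorphic_intros f)+
  have powers: "(\<lambda>n. ennreal (\<rho> n ^ 4)) \<longlonglongrightarrow> ennreal (1 ^ 4)"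
    "(\<lambda>n. ennreal (2 * (\<rho> n)\<^sup>2)) \<longlonglongrightarrow> ennreal (2 * 1\<^sup>2)"
    by (intro tendsto_ennrealI tendsto_intros \<rho>_lim)+
  have "(\<lambda>n. D' n (\<lambda>z. z\<^sup>2 * f z) + ennreal (\<rho> n ^ 4) * D' n f)
      \<longlonglongrightarrow> D (\<lambda>z. z\<^sup>2 * f z) + ennreal (1 ^ 4) * D f"
    by (intro tendsto_add tendsto_mult_ennreal D'_lim hol f powers) auto
  moreover have "(\<lambda>n. ennreal (2 * (\<rho> n)\<^sup>2) * D' n (\<lambda>z. z * f z))
      \<longlonglongrightarrow> ennreal (2 * 1\<^sup>2) * D (\<lambda>z. z * f z)"
    by (intro tendsto_mult_ennreal D'_lim hol powers) auto
  ultimately have "D (\<lambda>z. z\<^sup>2 * f z) + ennreal (1 ^ 4) * D f \<le> ennreal (2 * 1\<^sup>2) * D (\<lambda>z. z * f z)"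
    by (rule LIMSEQ_le) (use nn_integral_deriv_concave_ball[OF w f \<rho>_bounds] in \<open>simp add: D'_def\<close>)
  then show ?thesis by simp
qed

subsection \<open>The defect of the shift\<close>

definition shift_domain :: "(complex \<Rightarrow> ennreal) \<Rightarrow> (complex \<Rightarrow> complex) set" where
  "shift_domain \<omega> = {f. f holomorphic_on unit_disk \<and> (\<lambda>z. z * f z) \<in> dirichlet_space \<omega>}"

text \<open>For the Poisson kernel at a boundary point \<open>\<zeta>\<close> this is a multiple of \<open>|f \<zeta>|\<^sup>2\<close>.\<close>

definition defect :: "(complex \<Rightarrow> ennreal) \<Rightarrow> (complex \<Rightarrow> complex) \<Rightarrow> real" where
  "defect \<omega> f = energy \<omega> (\<lambda>z. z * f z) - energy \<omega> f"

lemma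
  assumes w: "superharmonic_weight \<omega>" and f: "f \<in> shift_domain \<omega>"
  shows shift_domain_imp_dirichlet_space: "f \<in> dirichlet_space \<omega>"
    and shift_domain_shift: "(\<lambda>z. z * f z) \<in> shift_domain \<omega>"
    and energy_concave:
      "energy \<omega> (\<lambda>z. z * (z * f z)) + energy \<omega> f \<le> 2 * energy \<omega> (\<lambda>z. z * f z)"
proof -
  have hol: "f holomorphic_on unit_disk" and zf: "(\<lambda>z. z * f z) \<in> dirichlet_space \<omega>"
    using f by (auto simp: shift_domain_def)
  let ?N = "\<lambda>g. \<integral>\<^sup>+z. ennreal ((cmod (deriv g z))\<^sup>2) \<partial>weighted_area \<omega> 1"
  have concave: "?N (\<lambda>z. z * (z * f z)) + ?N f \<le> 2 * ?N (\<lambda>z. z * f z)"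
    using nn_integral_deriv_concave[OF w hol] by (simp add: power2_eq_square mult.assoc)
  also have "\<dots> < \<infinity>"
    using zf by (simp add: nn_integral_deriv_eq_energy ennreal_mult_less_top)
  finally have "?N (\<lambda>z. z * (z * f z)) < \<infinity>" "?N f < \<infinity>"
    by auto
  moreover have "(\<lambda>z. z * (z * f z)) holomorphic_on unit_disk"
    by (intro holomorphic_intros hol)
  ultimately show f: "f \<in> dirichlet_space \<omega>" and "(\<lambda>z. z * f z) \<in> shift_domain \<omega>"
    using hol by (auto simp: dirichlet_space_iff_nn_integral shift_domain_def
        intro!: holomorphic_intros)
  then have "(\<lambda>z. z * (z * f z)) \<in> dirichlet_space \<omega>"
    by (simp add: shift_domain_def)
  with concave f zf have "ennreal (energy \<omega> (\<lambda>z. z * (z * f z)) + energy \<omega> f)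
      \<le> ennreal (2 * energy \<omega> (\<lambda>z. z * f z))"
    by (simp add: nn_integral_deriv_eq_energy ennreal_mult energy_nonneg)
  then show "energy \<omega> (\<lambda>z. z * (z * f z)) + energy \<omega> f \<le> 2 * energy \<omega> (\<lambda>z. z * f z)"
    by (subst (asm) ennreal_le_iff) (simp_all add: energy_nonneg)
qed

lemma shift_domain_lincomb:
  assumes "f \<in> shift_domain \<omega>" "g \<in> shift_domain \<omega>"
  shows "(\<lambda>z. a * f z + b * g z) \<in> shift_domain \<omega>"
  using assms dirichlet_space_lincomb[of "\<lambda>z. z * f z" \<omega> "\<lambda>z. z * g z" a b]
  by (auto simp: shift_domain_def algebra_simps intro!: holomorphic_intros)

lemma defect_shift_le:
  assumes "superharmonic_weight \<omega>" "f \<in> shift_domain \<omega>"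
  shows "defect \<omega> (\<lambda>z. z * f z) \<le> defect \<omega> f"
  using energy_concave[OF assms] by (simp add: defect_def)

lemma concave_nonneg_sequence_mono:
  fixes e :: "nat \<Rightarrow> real"
  assumes concave: "\<And>n. e (Suc (Suc n)) + e n \<le> 2 * e (Suc n)" and nonneg: "\<And>n. 0 \<le> e n"
  shows "e 0 \<le> e 1"
proof (rule ccontr)
  assume "\<not> e 0 \<le> e 1"
  then have decrease: "0 < e 0 - e 1" by simp
  have "e (Suc n) - e n \<le> e 1 - e 0 \<and> e n \<le> e 0 - real n * (e 0 - e 1)" for n
  proof (induction n)
    case (Suc n)
    then show ?case using concave[of n] by (simp add: algebra_simps)
  qed simp
  moreover obtain n where "e 0 < real n * (e 0 - e 1)"
    using reals_Archimedean3[OF decrease] by blast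
  ultimately show False using nonneg[of n] by (smt (verit))
qed

lemma defect_nonneg:
  assumes w: "superharmonic_weight \<omega>" and f: "f \<in> shift_domain \<omega>"
  shows "0 \<le> defect \<omega> f"
proof -
  define F where "F n = (\<lambda>z. z ^ n * f z)" for n :: nat
  have F_0: "F 0 = f" and F_Suc: "F (Suc n) = (\<lambda>z. z * F n z)" for n
    by (auto simp: F_def mult.assoc)
  have dom: "F n \<in> shift_domain \<omega>" for n
  proof (induction n)
    case (Suc n)
    then show ?case unfolding F_Suc by (rule shift_domain_shift[OF w])
  qed (simp add: F_0 f)
  have "energy \<omega> (F 0) \<le> energy \<omega> (F 1)"
    using energy_concave[OF w dom] energy_nonneg
    by (intro concave_nonneg_sequence_mono) (auto simp: F_Suc)
  then show ?thesis by (simp add: defect_def F_0 F_Suc)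
qed

lemma defect_real_lincomb:
  assumes w: "superharmonic_weight \<omega>" and f: "f \<in> shift_domain \<omega>" and g: "g \<in> shift_domain \<omega>"
  shows "defect \<omega> (\<lambda>z. of_real a * f z + of_real b * g z) = a\<^sup>2 * defect \<omega> f + b\<^sup>2 * defect \<omega> g
    + a * b * (defect \<omega> (\<lambda>z. f z + g z) - defect \<omega> f - defect \<omega> g)"
proof -
  note dom = shift_domain_imp_dirichlet_space[OF w f] shift_domain_imp_dirichlet_space[OF w g]
  have shift_dom: "(\<lambda>z. z * f z) \<in> dirichlet_space \<omega>" "(\<lambda>z. z * g z) \<in> dirichlet_space \<omega>"
    using f g by (auto simp: shift_domain_def)
  have distrib: "(\<lambda>z. z * (c * f z + d * g z)) = (\<lambda>z. c * (z * f z) + d * (z * g z))"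
    "(\<lambda>z. z * (f z + g z)) = (\<lambda>z. z * f z + z * g z)" for c d
    by (auto simp: algebra_simps)
  show ?thesis
    unfolding defect_def distrib energy_real_lincomb[OF dom] energy_real_lincomb[OF shift_dom]
    by (simp add: algebra_simps)
qed

text \<open>The coefficients are those for which the two sides differ by a multiple of the defect of
  \<open>m f - g\<close>.\<close>

lemma defect_fejer_le:
  assumes w: "superharmonic_weight \<omega>" and f: "f \<in> shift_domain \<omega>" and g: "g \<in> shift_domain \<omega>"
    and m: "0 < m" "m + 1 \<le> N"
  shows "defect \<omega> (\<lambda>z. of_real (m / N) * f z + of_real (- 1 / N) * g z)
      + defect \<omega> (\<lambda>z. f z + g z) / (m + 1) \<le> defect \<omega> f + defect \<omega> g / m"
proof -
  define x y s where "x = defect \<omega> f" and "y = defect \<omega> g" and "s = defect \<omega> (\<lambda>z. f z + g z)"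
  define d where "d = defect \<omega> (\<lambda>z. of_real m * f z + of_real (- 1) * g z)"
  have "m * (m + 1) \<le> N\<^sup>2"
    using m unfolding power2_eq_square by (intro mult_mono) auto
  then have "1 / N\<^sup>2 \<le> 1 / (m * (m + 1))"
    using m by (intro divide_left_mono) auto
  moreover have "0 \<le> d"
    unfolding d_def by (intro defect_nonneg[OF w] shift_domain_lincomb f g)
  ultimately have "0 \<le> (1 / (m * (m + 1)) - 1 / N\<^sup>2) * d"
    by simp
  also have "d = m\<^sup>2 * x + y - m * (s - x - y)"
    unfolding d_def defect_real_lincomb[OF w f g] x_def y_def s_def by simp
  also have "(1 / (m * (m + 1)) - 1 / N\<^sup>2) * (m\<^sup>2 * x + y - m * (s - x - y)) = x + y / m
      - ((m / N)\<^sup>2 * x + (- 1 / N)\<^sup>2 * y + m / N * (- 1 / N) * (s - x - y)) - s / (m + 1)"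
    using m by (simp add: power2_eq_square divide_simps) (simp add: algebra_simps)
  finally show ?thesis
    unfolding defect_real_lincomb[OF w f g] x_def y_def s_def by simp
qed

subsection \<open>Contractivity of the Cesaro means\<close>

lemma
  assumes "g holomorphic_on unit_disk" and tail: "\<And>z. z \<in> unit_disk \<Longrightarrow> f z = c + z * g z"
  shows energy_tail: "energy \<omega> f = energy \<omega> (\<lambda>z. z * g z)"
    and dirichlet_space_tail_iff: "f \<in> dirichlet_space \<omega> \<longleftrightarrow> (\<lambda>z. z * g z) \<in> dirichlet_space \<omega>"
proof -
  have hol: "(\<lambda>z. z * g z) holomorphic_on unit_disk"
    by (intro holomorphic_intros assms)
  show "energy \<omega> f = energy \<omega> (\<lambda>z. z * g z)"
    using energy_cong[OF tail] energy_add_const[OF hol] by simp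
  show "f \<in> dirichlet_space \<omega> \<longleftrightarrow> (\<lambda>z. z * g z) \<in> dirichlet_space \<omega>"
    using dirichlet_space_cong[OF tail] dirichlet_space_add_const_iff[OF hol] by simp
qed

lemma energy_eq_sum_defect_tails:
  assumes "\<And>k. k < n \<Longrightarrow> g (Suc k) holomorphic_on unit_disk"
    and "\<And>k z. k < n \<Longrightarrow> z \<in> unit_disk \<Longrightarrow> g k z = c k + z * g (Suc k) z"
  shows "energy \<omega> (g 0) = (\<Sum>k<n. defect \<omega> (g (Suc k))) + energy \<omega> (g n)"
  using assms
proof (induction n)
  case (Suc n)
  have "energy \<omega> (g n) = energy \<omega> (\<lambda>z. z * g (Suc n) z)"
    using Suc.prems by (intro energy_tail[where c = "c n"]) auto
  with Suc show ?case by (simp add: defect_def)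
qed simp

lemma taylor_coeff_sums:
  assumes "f holomorphic_on unit_disk" "z \<in> unit_disk"
  shows "(\<lambda>k. taylor_coeff f k * z ^ k) sums f z"
  using holomorphic_power_series[OF assms] by (simp add: taylor_coeff_def)

definition taylor_tail :: "(complex \<Rightarrow> complex) \<Rightarrow> nat \<Rightarrow> complex \<Rightarrow> complex" where
  "taylor_tail f k z = (\<Sum>j. taylor_coeff f (j + k) * z ^ j)"

lemma taylor_tail_0:
  assumes "f holomorphic_on unit_disk" "z \<in> unit_disk"
  shows "taylor_tail f 0 z = f z"
  using taylor_coeff_sums[OF assms] by (simp add: taylor_tail_def sums_iff)

lemma summable_taylor_tail:
  assumes "f holomorphic_on unit_disk" "z \<in> unit_disk"
  shows "summable (\<lambda>j. taylor_coeff f (j + k) * z ^ j)"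
  using taylor_coeff_sums[OF assms]
  by (subst summable_powser_ignore_initial_segment) (simp add: sums_iff)

lemma taylor_tail_Suc:
  assumes "f holomorphic_on unit_disk" "z \<in> unit_disk"
  shows "taylor_tail f k z = taylor_coeff f k + z * taylor_tail f (Suc k) z"
  using powser_split_head(1)[OF summable_taylor_tail[OF assms, of k]] by (simp add: taylor_tail_def)

lemma taylor_tail_holomorphic:
  assumes "f holomorphic_on unit_disk"
  shows "taylor_tail f k holomorphic_on unit_disk"
proof (rule power_series_holomorphic)
  fix z assume "z \<in> unit_disk"
  then show "(\<lambda>j. taylor_coeff f (j + k) * (z - 0) ^ j) sums taylor_tail f k z"
    using summable_taylor_tail[OF assms, of z k] by (simp add: taylor_tail_def summable_sums)
qed

lemma partial_sum_add_taylor_tail: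
  assumes "f holomorphic_on unit_disk" "z \<in> unit_disk"
  shows "partial_sum k f z + z ^ Suc k * taylor_tail f (Suc k) z = f z"
proof (induction k)
  case 0
  then show ?case
    using taylor_tail_Suc[OF assms, of 0] taylor_tail_0[OF assms] by (simp add: partial_sum_def)
next
  case (Suc k)
  then show ?case
    using taylor_tail_Suc[OF assms, of "Suc k"] by (simp add: partial_sum_def algebra_simps)
qed

lemma taylor_tail_shift_domain:
  assumes w: "superharmonic_weight \<omega>" and f: "f \<in> dirichlet_space \<omega>"
  shows "taylor_tail f (Suc k) \<in> shift_domain \<omega>"
proof -
  note hol = dirichlet_space_holomorphic[OF f]
  have tail_iff: "taylor_tail f k \<in> dirichlet_space \<omega>
      \<longleftrightarrow> taylor_tail f (Suc k) \<in> shift_domain \<omega>" for k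
    using dirichlet_space_tail_iff
      [OF taylor_tail_holomorphic[OF hol, of "Suc k"] taylor_tail_Suc[OF hol, of _ k]]
    by (simp add: shift_domain_def taylor_tail_holomorphic[OF hol])
  have "taylor_tail f k \<in> dirichlet_space \<omega>"
  proof (induction k)
    case 0
    then show ?case
      using f dirichlet_space_cong[OF taylor_tail_0[OF hol]] by simp
  next
    case (Suc k)
    then show ?case
      unfolding tail_iff[of k] by (rule shift_domain_imp_dirichlet_space[OF w])
  qed
  then show ?thesis by (simp add: tail_iff)
qed

definition tail_sum :: "(complex \<Rightarrow> complex) \<Rightarrow> nat \<Rightarrow> nat \<Rightarrow> complex \<Rightarrow> complex" where
  "tail_sum f N k z = (\<Sum>j=Suc k..N. z ^ (j - k) * taylor_tail f j z)"

lemma tail_sum_self: "tail_sum f N N = (\<lambda>_. 0)"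
  by (simp add: tail_sum_def fun_eq_iff)

lemma tail_sum_Suc:
  assumes "k < N"
  shows "tail_sum f N k z = z * (taylor_tail f (Suc k) z + tail_sum f N (Suc k) z)"
proof -
  have "tail_sum f N k z = z * taylor_tail f (Suc k) z
      + (\<Sum>j=Suc (Suc k)..N. z ^ (j - k) * taylor_tail f j z)"
    using assms by (simp add: tail_sum_def sum.atLeast_Suc_atMost)
  also have "(\<Sum>j=Suc (Suc k)..N. z ^ (j - k) * taylor_tail f j z)
      = (\<Sum>j=Suc (Suc k)..N. z * (z ^ (j - Suc k) * taylor_tail f j z))"
    by (intro sum.cong refl) (auto simp: Suc_diff_Suc simp flip: power_Suc mult.assoc)
  finally show ?thesis
    by (simp add: tail_sum_def distrib_left flip: sum_distrib_left)
qed

lemma tail_sum_shift_domain: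
  assumes w: "superharmonic_weight \<omega>" and f: "f \<in> dirichlet_space \<omega>" and "k \<le> N"
  shows "tail_sum f N k \<in> shift_domain \<omega>"
  using \<open>k \<le> N\<close>
proof (induction k rule: inc_induct)
  case base
  show ?case
    by (simp add: tail_sum_self shift_domain_def dirichlet_space_def)
next
  case (step k)
  have "(\<lambda>z. taylor_tail f (Suc k) z + tail_sum f N (Suc k) z) \<in> shift_domain \<omega>"
    using shift_domain_lincomb[OF taylor_tail_shift_domain[OF w f] step.IH,
        where a = 1 and b = 1] by simp
  then have "(\<lambda>z. z * (taylor_tail f (Suc k) z + tail_sum f N (Suc k) z)) \<in> shift_domain \<omega>"
    by (rule shift_domain_shift[OF w])
  then show ?case
    by (simp add: tail_sum_Suc[OF step.hyps(2), abs_def])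
qed

text \<open>The Taylor tails of the Cesaro mean of order \<open>N - 1\<close>.\<close>

definition cesaro_tail :: "nat \<Rightarrow> (complex \<Rightarrow> complex) \<Rightarrow> nat \<Rightarrow> complex \<Rightarrow> complex" where
  "cesaro_tail N f k z = of_real ((real N - real k) / real N) * taylor_tail f k z
     + of_real (- 1 / real N) * tail_sum f N k z"

lemma cesaro_tail_0:
  assumes f: "f holomorphic_on unit_disk" and z: "z \<in> unit_disk"
  shows "cesaro_tail (Suc n) f 0 z = cesaro_mean n f z"
proof -
  have "tail_sum f (Suc n) 0 z = (\<Sum>j\<le>n. z ^ Suc j * taylor_tail f (Suc j) z)"
    unfolding tail_sum_def atMost_atLeast0
    by (subst sum.atLeast_Suc_atMost_Suc_shift) simp
  also have "\<dots> = (\<Sum>j\<le>n. f z - partial_sum j f z)"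
    using partial_sum_add_taylor_tail[OF f z] by (intro sum.cong) (auto simp: algebra_simps)
  also have "\<dots> = of_nat (Suc n) * f z - (\<Sum>j\<le>n. partial_sum j f z)"
    by (simp add: sum_subtractf)
  finally show ?thesis
    by (simp add: cesaro_tail_def cesaro_mean_def taylor_tail_0[OF f z] field_simps
        del: of_nat_Suc)
qed

lemma cesaro_tail_Suc:
  assumes f: "f holomorphic_on unit_disk" and z: "z \<in> unit_disk" and k: "k < N"
  shows "cesaro_tail N f k z
    = of_real ((real N - real k) / real N) * taylor_coeff f k + z * cesaro_tail N f (Suc k) z"
proof -
  have "of_real (real N) \<noteq> (0::complex)"
    using k by simp
  then show ?thesis
    unfolding cesaro_tail_def tail_sum_Suc[OF k] taylor_tail_Suc[OF f z, of k]
    by (simp add: divide_simps) (simp add: algebra_simps)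
qed

lemma cesaro_tail_self: "cesaro_tail N f N = (\<lambda>_. 0)"
  by (simp add: cesaro_tail_def tail_sum_self fun_eq_iff)

lemma cesaro_tail_shift_domain:
  assumes "superharmonic_weight \<omega>" "f \<in> dirichlet_space \<omega>" "Suc k \<le> N"
  shows "cesaro_tail N f (Suc k) \<in> shift_domain \<omega>"
  unfolding cesaro_tail_def[abs_def]
  by (intro shift_domain_lincomb taylor_tail_shift_domain tail_sum_shift_domain assms)

text \<open>For \<open>k = N - 1\<close> the last term is \<open>0\<close>, both as \<open>x / 0\<close> and because \<open>tail_sum f N N = 0\<close>.\<close>

lemma defect_cesaro_tail_le:
  assumes w: "superharmonic_weight \<omega>" and f: "f \<in> dirichlet_space \<omega>" and k: "k < N"
  shows "defect \<omega> (cesaro_tail N f (Suc k)) + defect \<omega> (tail_sum f N k) / (real N - real k)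
    \<le> defect \<omega> (taylor_tail f (Suc k)) + defect \<omega> (tail_sum f N (Suc k)) / (real N - real (Suc k))"
proof -
  let ?g = "taylor_tail f (Suc k)" and ?t = "tail_sum f N (Suc k)"
  have dom: "?g \<in> shift_domain \<omega>" "?t \<in> shift_domain \<omega>"
    using k by (auto intro: taylor_tail_shift_domain[OF w f] tail_sum_shift_domain[OF w f])
  have "(\<lambda>z. ?g z + ?t z) \<in> shift_domain \<omega>"
    using shift_domain_lincomb[OF dom, where a = 1 and b = 1] by simp
  then have shift: "defect \<omega> (tail_sum f N k) \<le> defect \<omega> (\<lambda>z. ?g z + ?t z)"
    unfolding tail_sum_Suc[OF k, abs_def] by (rule defect_shift_le[OF w])
  show ?thesis
  proof (cases "Suc k = N")
    case True
    then have "real N - real k = 1" by auto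
    with shift show ?thesis
      by (simp add: True cesaro_tail_self tail_sum_self defect_def)
  next
    case False
    define m where "m = real N - real (Suc k)"
    have m: "0 < m" "m + 1 \<le> real N"
      using False k by (auto simp: m_def)
    have "defect \<omega> (cesaro_tail N f (Suc k)) + defect \<omega> (\<lambda>z. ?g z + ?t z) / (m + 1)
        \<le> defect \<omega> ?g + defect \<omega> ?t / m"
      using defect_fejer_le[OF w dom m] by (simp add: cesaro_tail_def[abs_def] m_def)
    moreover have "defect \<omega> (tail_sum f N k) / (m + 1) \<le> defect \<omega> (\<lambda>z. ?g z + ?t z) / (m + 1)"
      using shift m by (intro divide_right_mono) auto
    moreover have step: "real N - real k = m + 1"
      by (simp add: m_def)
    ultimately show ?thesis
      unfolding m_def[symmetric] step by linarith
  qed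
qed

lemma sum_defect_cesaro_tail_le:
  assumes w: "superharmonic_weight \<omega>" and f: "f \<in> dirichlet_space \<omega>"
  shows "(\<Sum>k<N. defect \<omega> (cesaro_tail N f (Suc k))) \<le> (\<Sum>k<N. defect \<omega> (taylor_tail f (Suc k)))"
proof -
  define L where "L k = defect \<omega> (tail_sum f N k) / (real N - real k)" for k
  have "(\<Sum>k<N. defect \<omega> (cesaro_tail N f (Suc k)) - defect \<omega> (taylor_tail f (Suc k)))
      \<le> (\<Sum>k<N. L (Suc k) - L k)"
    using defect_cesaro_tail_le[OF assms] by (intro sum_mono) (simp add: L_def algebra_simps)
  also have "\<dots> = L N - L 0"
    by (rule sum_lessThan_telescope)
  also have "\<dots> \<le> 0"
    using defect_nonneg[OF w tail_sum_shift_domain[OF w f]] by (simp add: L_def)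
  finally show ?thesis by (simp add: sum_subtractf)
qed

lemma
  assumes w: "superharmonic_weight \<omega>" and f: "f \<in> dirichlet_space \<omega>"
  shows cesaro_mean_dirichlet_space: "cesaro_mean n f \<in> dirichlet_space \<omega>"
    and energy_cesaro_mean_le: "energy \<omega> (cesaro_mean n f) \<le> energy \<omega> f"
proof -
  note hol = dirichlet_space_holomorphic[OF f]
  note cesaro_dom = cesaro_tail_shift_domain[OF w f, of _ "Suc n"]
  have "cesaro_tail (Suc n) f 0 \<in> dirichlet_space \<omega>"
    using dirichlet_space_tail_iff[OF _ cesaro_tail_Suc[OF hol, of _ 0 "Suc n"]] cesaro_dom[of 0]
    by (simp add: shift_domain_def)
  then show "cesaro_mean n f \<in> dirichlet_space \<omega>"
    using dirichlet_space_cong[OF cesaro_tail_0[OF hol]] by simp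
  have "energy \<omega> (cesaro_mean n f) = energy \<omega> (cesaro_tail (Suc n) f 0)"
    using energy_cong[OF cesaro_tail_0[OF hol]] by simp
  also have "\<dots> = (\<Sum>k<Suc n. defect \<omega> (cesaro_tail (Suc n) f (Suc k)))
      + energy \<omega> (cesaro_tail (Suc n) f (Suc n))"
    using cesaro_dom
    by (intro energy_eq_sum_defect_tails
          [where c = "\<lambda>k. of_real ((real (Suc n) - real k) / real (Suc n)) * taylor_coeff f k"])
      (auto simp: shift_domain_def cesaro_tail_Suc[OF hol])
  also have "energy \<omega> (cesaro_tail (Suc n) f (Suc n)) = 0"
    by (simp add: cesaro_tail_self)
  also have "(\<Sum>k<Suc n. defect \<omega> (cesaro_tail (Suc n) f (Suc k))) + 0
      \<le> (\<Sum>k<Suc n. defect \<omega> (taylor_tail f (Suc k))) + energy \<omega> (taylor_tail f (Suc n))"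
    using energy_nonneg by (intro add_mono sum_defect_cesaro_tail_le[OF w f])
  also have "\<dots> = energy \<omega> (taylor_tail f 0)"
    by (intro energy_eq_sum_defect_tails[where c = "taylor_coeff f", symmetric]
        taylor_tail_holomorphic[OF hol] taylor_tail_Suc[OF hol])
  also have "\<dots> = energy \<omega> f"
    using energy_cong[OF taylor_tail_0[OF hol]] by simp
  finally show "energy \<omega> (cesaro_mean n f) \<le> energy \<omega> f" .
qed

subsection \<open>Convergence of the Cesaro means\<close>

lemma LIMSEQ_arithmetic_mean:
  fixes x :: "nat \<Rightarrow> 'a::real_normed_field"
  assumes "x \<longlonglongrightarrow> L"
  shows "(\<lambda>n. (\<Sum>k\<le>n. x k) / of_nat (Suc n)) \<longlonglongrightarrow> L"
proof (rule tendstoI)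
  fix e :: real assume e: "0 < e"
  obtain M where M: "\<And>k. M \<le> k \<Longrightarrow> norm (x k - L) < e / 2"
    using LIMSEQ_D[OF assms, of "e / 2"] e by auto
  define A where "A = (\<Sum>k<M. norm (x k - L))"
  have "(\<lambda>n. A / real (Suc n)) \<longlonglongrightarrow> 0"
    by (rule LIMSEQ_Suc[OF lim_const_over_n])
  then have "\<forall>\<^sub>F n in sequentially. A / real (Suc n) < e / 2"
    using e by (intro order_tendstoD(2)) auto
  then show "\<forall>\<^sub>F n in sequentially. dist ((\<Sum>k\<le>n. x k) / of_nat (Suc n)) L < e"
    using eventually_ge_at_top[of M]
  proof eventually_elim
    case (elim n)
    have "norm (\<Sum>k\<le>n. x k - L) \<le> (\<Sum>k\<le>n. norm (x k - L))"
      by (rule norm_sum)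
    also have "\<dots> \<le> (\<Sum>k\<le>n. (if k < M then norm (x k - L) else 0) + e / 2)"
      using M e by (intro sum_mono) (auto simp: not_less less_imp_le)
    also have "\<dots> = A + real (Suc n) * (e / 2)"
      using elim(2) unfolding A_def
      by (simp add: sum.distrib sum.If_cases Int_absorb1 lessThan_def[symmetric] subset_eq)
    finally have bound: "norm (\<Sum>k\<le>n. x k - L) \<le> A + real (Suc n) * (e / 2)" .
    have "(\<Sum>k\<le>n. x k) / of_nat (Suc n) - L = (\<Sum>k\<le>n. x k - L) / of_nat (Suc n)"
      by (simp add: sum_subtractf field_simps del: of_nat_Suc)
    then have "dist ((\<Sum>k\<le>n. x k) / of_nat (Suc n)) L = norm (\<Sum>k\<le>n. x k - L) / real (Suc n)"
      by (simp add: dist_norm norm_divide del: of_nat_Suc)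
    also have "\<dots> \<le> (A + real (Suc n) * (e / 2)) / real (Suc n)"
      using bound by (intro divide_right_mono) auto
    also have "\<dots> = A / real (Suc n) + e / 2"
      by (simp add: add_divide_distrib del: of_nat_Suc)
    finally show ?case using elim(1) by linarith
  qed
qed

lemma partial_sum_holomorphic: "partial_sum k f holomorphic_on A"
  unfolding partial_sum_def[abs_def] by (intro holomorphic_intros)

lemma cesaro_mean_holomorphic: "cesaro_mean k f holomorphic_on A"
  unfolding cesaro_mean_def[abs_def]
  by (intro holomorphic_intros partial_sum_holomorphic) (simp del: of_nat_Suc)

lemma LIMSEQ_deriv_partial_sum:
  assumes f: "f holomorphic_on unit_disk" and z: "z \<in> unit_disk"
  shows "(\<lambda>k. deriv (partial_sum k f) z) \<longlonglongrightarrow> deriv f z"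
proof -
  have "taylor_coeff f (Suc k) = (deriv ^^ k) (deriv f) 0 / (of_nat (Suc k) * fact k)" for k
    by (simp only: taylor_coeff_def funpow_Suc_right o_apply
        fact_Suc of_nat_mult of_nat_id of_nat_fact)
  then have "(deriv ^^ k) (deriv f) 0 / fact k = of_nat (Suc k) * taylor_coeff f (Suc k)" for k
    by (simp del: of_nat_Suc)
  then have "(\<lambda>n. \<Sum>k<n. of_nat (Suc k) * taylor_coeff f (Suc k) * z ^ k) \<longlonglongrightarrow> deriv f z"
    using holomorphic_power_series[OF holomorphic_deriv[OF f open_ball] z] by (simp add: sums_def)
  moreover have "deriv (partial_sum n f) z
      = (\<Sum>k<n. of_nat (Suc k) * taylor_coeff f (Suc k) * z ^ k)" for n
  proof -
    have "(partial_sum n f has_field_derivative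
        (\<Sum>k\<le>n. taylor_coeff f k * (of_nat k * z ^ (k - 1)))) (at z)"
      unfolding partial_sum_def[abs_def] by (auto intro!: derivative_eq_intros sum.cong)
    then have "deriv (partial_sum n f) z = (\<Sum>k\<le>n. taylor_coeff f k * (of_nat k * z ^ (k - 1)))"
      by (rule DERIV_imp_deriv)
    also have "\<dots> = (\<Sum>k<n. of_nat (Suc k) * taylor_coeff f (Suc k) * z ^ k)"
      by (subst sum.atMost_shift) (auto intro!: sum.cong)
    finally show ?thesis .
  qed
  ultimately show ?thesis by simp
qed

lemma LIMSEQ_deriv_cesaro_mean:
  assumes f: "f holomorphic_on unit_disk" and z: "z \<in> unit_disk"
  shows "(\<lambda>n. deriv (cesaro_mean n f) z) \<longlonglongrightarrow> deriv f z"
proof -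
  have "deriv (cesaro_mean n f) z = (\<Sum>k\<le>n. deriv (partial_sum k f) z) / of_nat (Suc n)" for n
    unfolding cesaro_mean_def[abs_def] Suc_eq_plus1
    by (intro DERIV_imp_deriv DERIV_cdivide DERIV_sum
        holomorphic_derivI[OF partial_sum_holomorphic open_ball z])
  then show ?thesis
    using LIMSEQ_arithmetic_mean[OF LIMSEQ_deriv_partial_sum[OF f z]] by simp
qed

text \<open>By the parallelogram law, it suffices that the norms of \<open>F n + f\<close> converge to that of
  \<open>2 f\<close>, which is Scheffe's lemma for \<open>(norm (F n + f))\<^sup>2\<close>.\<close>

lemma integral_square_norm_diff_LIMSEQ_0:
  fixes F :: "nat \<Rightarrow> 'a \<Rightarrow> 'b::{real_inner, second_countable_topology}"
  assumes [measurable]: "\<And>n. F n \<in> borel_measurable M" "f \<in> borel_measurable M"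
    and int: "\<And>n. integrable M (\<lambda>x. (norm (F n x))\<^sup>2)" "integrable M (\<lambda>x. (norm (f x))\<^sup>2)"
    and lim: "AE x in M. (\<lambda>n. F n x) \<longlonglongrightarrow> f x"
    and le: "\<And>n. (\<integral>x. (norm (F n x))\<^sup>2 \<partial>M) \<le> (\<integral>x. (norm (f x))\<^sup>2 \<partial>M)"
  shows "(\<lambda>n. \<integral>x. (norm (F n x - f x))\<^sup>2 \<partial>M) \<longlonglongrightarrow> 0"
proof -
  define G where "G n x = (norm (F n x + f x))\<^sup>2" for n x
  define g where "g x = 4 * (norm (f x))\<^sup>2" for x
  have parallelogram: "(norm (F n x - f x))\<^sup>2
      = 2 * (norm (F n x))\<^sup>2 + 2 * (norm (f x))\<^sup>2 - G n x" for n x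
    by (simp add: G_def power2_norm_eq_inner inner_simps inner_commute)
  have nonneg: "0 \<le> G n x" "0 \<le> g x" for n x
    by (simp_all add: G_def g_def)
  have int_g: "integrable M g"
    unfolding g_def using int by simp
  have int_G: "integrable M (G n)" for n
    unfolding G_def using int by (intro integrable_square_norm_add) auto
  have integral_diff: "(\<integral>x. (norm (F n x - f x))\<^sup>2 \<partial>M) \<le> (\<integral>x. g x \<partial>M) - (\<integral>x. G n x \<partial>M)" for n
    unfolding parallelogram using int int_G le[of n] by (simp add: g_def)
  have "0 \<le> (\<integral>x. (norm (F n x - f x))\<^sup>2 \<partial>M)" for n
    by simp
  then have G_int_le: "(\<integral>x. G n x \<partial>M) \<le> (\<integral>x. g x \<partial>M)" for n
    using integral_diff[of n] by (metis diff_ge_0_iff_ge order_trans)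
  have "(\<lambda>n. \<integral>\<^sup>+x. norm (G n x - g x) \<partial>M) \<longlonglongrightarrow> 0"
  proof (rule Scheffe_lemma2)
    show "AE x in M. (\<lambda>n. G n x) \<longlonglongrightarrow> g x"
      using lim
    proof eventually_elim
      case (elim x)
      then have "(\<lambda>n. G n x) \<longlonglongrightarrow> (norm (f x + f x))\<^sup>2"
        unfolding G_def by (intro tendsto_intros)
      then show ?case
        by (simp add: g_def power2_norm_eq_inner inner_simps)
    qed
    show "(\<integral>\<^sup>+x. norm (G n x) \<partial>M) \<le> (\<integral>\<^sup>+x. norm (g x) \<partial>M)" for n
      using G_int_le[of n] int_G int_g by (simp add: nonneg nn_integral_eq_integral ennreal_leI)
  qed (use int_G int_g in auto)
  then have "(\<lambda>n. \<integral>x. G n x \<partial>M) \<longlonglongrightarrow> (\<integral>x. g x \<partial>M)"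
    by (intro tendsto_L1_int int_G int_g)
  from tendsto_diff[OF tendsto_const[of "\<integral>x. g x \<partial>M"] this]
  have gap: "(\<lambda>n. (\<integral>x. g x \<partial>M) - (\<integral>x. G n x \<partial>M)) \<longlonglongrightarrow> 0"
    by simp
  show ?thesis
    using integral_diff
    by (intro tendsto_sandwich[OF always_eventually always_eventually tendsto_const gap]) simp_all
qed

lemma energy_cesaro_mean_diff_LIMSEQ_0:
  assumes w: "superharmonic_weight \<omega>" and f: "f \<in> dirichlet_space \<omega>"
  shows "(\<lambda>n. energy \<omega> (\<lambda>z. cesaro_mean n f z - f z)) \<longlonglongrightarrow> 0"
proof -
  note hol = dirichlet_space_holomorphic[OF f]
  have "deriv (\<lambda>z. cesaro_mean n f z - f z) z = deriv (cesaro_mean n f) z - deriv f z"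
    if "z \<in> unit_disk" for n z
    using deriv_lincomb[OF cesaro_mean_holomorphic hol that, of 1 n f "-1"] by simp
  then have "energy \<omega> (\<lambda>z. cesaro_mean n f z - f z)
      = (\<integral>z. (cmod (deriv (cesaro_mean n f) z - deriv f z))\<^sup>2 \<partial>weighted_area \<omega> 1)" for n
    unfolding energy_def by (intro Bochner_Integration.integral_cong) auto
  moreover have "(\<lambda>n. \<integral>z. (cmod (deriv (cesaro_mean n f) z - deriv f z))\<^sup>2 \<partial>weighted_area \<omega> 1) \<longlonglongrightarrow> 0"
  proof (rule integral_square_norm_diff_LIMSEQ_0)
    show "AE z in weighted_area \<omega> 1. (\<lambda>n. deriv (cesaro_mean n f) z) \<longlonglongrightarrow> deriv f z"
      using LIMSEQ_deriv_cesaro_mean[OF hol] by (intro AE_I2) auto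
    show "(\<integral>z. (cmod (deriv (cesaro_mean n f) z))\<^sup>2 \<partial>weighted_area \<omega> 1)
        \<le> (\<integral>z. (cmod (deriv f z))\<^sup>2 \<partial>weighted_area \<omega> 1)" for n
      using energy_cesaro_mean_le[OF w f] by (simp add: energy_def)
  qed (use f cesaro_mean_dirichlet_space[OF w f] borel_measurable_deriv[OF hol]
      borel_measurable_deriv[OF cesaro_mean_holomorphic] in \<open>auto simp: dirichlet_space_def\<close>)
  ultimately show ?thesis by simp
qed

lemma D_norm_sq_diff_eq_energy:
  assumes "superharmonic_weight \<omega>" "f \<in> dirichlet_space \<omega>" "g \<in> dirichlet_space \<omega>" "f 0 = g 0"
  shows "D_norm_sq \<omega> (\<lambda>z. f z - g z) = ennreal (energy \<omega> (\<lambda>z. f z - g z) / pi)"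
  using dirichlet_space_lincomb[OF assms(2,3), of 1 "-1"] assms(1,4)
  by (simp add: D_norm_sq_def dirichlet_integral_eq_energy)

lemma D_norm_sq_cesaro_mean_diff_LIMSEQ_0:
  assumes w: "superharmonic_weight \<omega>" and f: "f \<in> dirichlet_space \<omega>"
  shows "(\<lambda>n. D_norm_sq \<omega> (\<lambda>z. cesaro_mean n f z - f z)) \<longlonglongrightarrow> 0"
proof -
  have "partial_sum k f 0 = f 0" for k
    using partial_sum_add_taylor_tail[OF dirichlet_space_holomorphic[OF f], of 0 k] by simp
  then have "cesaro_mean n f 0 = f 0" for n
    by (simp add: cesaro_mean_def field_simps del: of_nat_Suc)
  then have "D_norm_sq \<omega> (\<lambda>z. cesaro_mean n f z - f z)
      = ennreal (energy \<omega> (\<lambda>z. cesaro_mean n f z - f z) / pi)" for n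
    by (intro D_norm_sq_diff_eq_energy cesaro_mean_dirichlet_space w f)
  moreover have "(\<lambda>n. ennreal (energy \<omega> (\<lambda>z. cesaro_mean n f z - f z) / pi)) \<longlonglongrightarrow> ennreal (0 / pi)"
    by (intro tendsto_ennrealI tendsto_intros energy_cesaro_mean_diff_LIMSEQ_0 w f) simp
  ultimately show ?thesis by simp
qed

subsection \<open>Harmonic weights\<close>

lemma circle_mean_Re_holomorphic:
  assumes g: "g holomorphic_on cball a r" and r: "0 < r"
    and nonneg: "\<And>z. z \<in> cball a r \<Longrightarrow> 0 \<le> Re (g z)"
  shows "circle_mean (\<lambda>z. ennreal (Re (g z))) a r = ennreal (Re (g a))"
proof (rule circle_mean_eq_ennreal)
  have "((\<lambda>t. g (a + of_real r * cis t)) has_integral of_real (2 * pi) * g a) {0..2*pi}"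
    using has_integral_circle_cauchy_coeff[OF g r, of 0] by simp
  from has_integral_linear[OF this bounded_linear_Re]
  show "((\<lambda>t. Re (g (a + of_real r * cis t))) has_integral 2 * pi * Re (g a)) {0..2*pi}"
    by (simp add: o_def)
  show "0 \<le> Re (g z)" if "cmod (z - a) = \<bar>r\<bar>" for z
    using that r by (intro nonneg) (simp add: dist_norm norm_minus_commute)
qed

lemma superharmonic_weight_Re_holomorphic:
  assumes g: "g holomorphic_on unit_disk" and pos: "\<And>z. z \<in> unit_disk \<Longrightarrow> 0 < Re (g z)"
  shows "superharmonic_weight (\<lambda>z. ennreal (Re (g z)))"
  unfolding superharmonic_weight_def
proof (intro conjI ballI allI impI)
  fix z assume z: "z \<in> unit_disk"
  show "0 < ennreal (Re (g z))" using pos[OF z] by simp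
  have "isCont g z"
    using holomorphic_on_imp_continuous_on[OF g] z by (simp add: continuous_on_eq_continuous_at)
  then have "((\<lambda>z. ennreal (Re (g z))) \<longlongrightarrow> ennreal (Re (g z))) (at z)"
    by (intro tendsto_ennrealI tendsto_Re) (simp add: isCont_def)
  then show "ennreal (Re (g z)) \<le> Liminf (at z) (\<lambda>z. ennreal (Re (g z)))"
    by (simp add: lim_imp_Liminf)
next
  show "\<exists>z\<in>unit_disk. ennreal (Re (g z)) < \<infinity>"
    by (intro bexI[of _ 0]) auto
next
  fix a :: complex and r :: real
  assume r: "0 < r" and sub: "cball a r \<subseteq> unit_disk"
  have "0 \<le> Re (g z)" if "z \<in> cball a r" for z
    using pos sub that by (blast intro: less_imp_le)
  then have "circle_mean (\<lambda>z. ennreal (Re (g z))) a r = ennreal (Re (g a))"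
    by (rule circle_mean_Re_holomorphic[OF holomorphic_on_subset[OF g sub] r])
  then show "(\<integral>\<^sup>+t\<in>{0..2*pi}. ennreal (Re (g (a + complex_of_real r * cis t))) \<partial>lborel)
      / ennreal (2*pi)
      \<le> ennreal (Re (g a))"
    by (simp add: circle_mean_def)
qed

lemma emeasure_unit_disk_cmod_square_greater:
  "emeasure lborel {z \<in> unit_disk. s < (cmod z)\<^sup>2} = ennreal pi * emeasure lborel ({0..1} \<inter> {s<..})"
proof -
  consider "s < 0" | "0 \<le> s" "s < 1" | "1 \<le> s" by linarith
  then show ?thesis
  proof cases
    case 1
    then have "{z \<in> unit_disk. s < (cmod z)\<^sup>2} = unit_disk" "{0..1} \<inter> {s<..} = {0..1}"
      by (auto intro: less_le_trans)
    then show ?thesis by (simp add: emeasure_ball eval_unit_ball_vol)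
  next
    case 2
    have greater_iff: "s < (cmod z)\<^sup>2 \<longleftrightarrow> sqrt s < cmod z" for z
      using real_sqrt_less_iff[of s "(cmod z)\<^sup>2"] by simp
    have "cball 0 (sqrt s) \<subseteq> unit_disk"
      using 2 by (simp add: cball_subset_ball_iff)
    have "{z \<in> unit_disk. s < (cmod z)\<^sup>2} = unit_disk - cball 0 (sqrt s)"
      unfolding greater_iff by auto
    also have "emeasure lborel \<dots>
        = emeasure lborel unit_disk - emeasure lborel (cball (0::complex) (sqrt s))"
      using emeasure_lborel_cball_finite[of "0::complex" "sqrt s"]
      by (intro emeasure_Diff \<open>cball 0 (sqrt s) \<subseteq> unit_disk\<close>) auto
    also have "\<dots> = ennreal pi - ennreal (pi * s)"
      using 2 by (simp add: emeasure_ball emeasure_cball eval_unit_ball_vol)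
    also have "\<dots> = ennreal pi * ennreal (1 - s)"
      using 2 by (simp add: ennreal_minus right_diff_distrib flip: ennreal_mult)
    also have "ennreal (1 - s) = emeasure lborel {s<..1}"
      using 2 by simp
    also have "{s<..1} = {0..1} \<inter> {s<..}"
      using 2 by auto
    finally show ?thesis .
  next
    case 3
    have "(cmod z)\<^sup>2 < 1" if "z \<in> unit_disk" for z
      using that by (simp add: abs_square_less_1)
    then have "{z \<in> unit_disk. s < (cmod z)\<^sup>2} = {}"
      using 3 by force
    moreover have "{0..1} \<inter> {s<..} = {}"
      using 3 by auto
    ultimately show ?thesis by (simp only: emeasure_empty mult_zero_right)
  qed
qed

lemma distr_cmod_square_unit_disk:
  "distr (restrict_space lborel unit_disk) borel (\<lambda>z. (cmod z)\<^sup>2)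
    = density lborel (\<lambda>s. ennreal pi * indicator {0..1} s)"
    (is "?M = ?N")
proof (rule measure_eqI_lessThan)
  fix s :: real
  have "emeasure ?M {s<..}
      = emeasure (restrict_space lborel unit_disk) {z \<in> unit_disk. s < (cmod z)\<^sup>2}"
    by (subst emeasure_distr) (auto simp: space_restrict_space intro!: measurable_restrict_space1
        intro: arg_cong[where f = "emeasure _"])
  also have "\<dots> = emeasure lborel {z \<in> unit_disk. s < (cmod z)\<^sup>2}"
    by (rule emeasure_restrict_space) auto
  also have "\<dots> = ennreal pi * emeasure lborel ({0..1} \<inter> {s<..})"
    by (rule emeasure_unit_disk_cmod_square_greater)
  also have "\<dots> = emeasure ?N {s<..}"
    by (simp add: emeasure_density mult.assoc nn_integral_cmult flip: indicator_inter_arith)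
  finally show "emeasure ?M {s<..} = emeasure ?N {s<..}" .
  have "emeasure ?M {s<..} \<le> emeasure ?M (space ?M)"
    by (rule emeasure_space)
  also have "\<dots> = emeasure lborel unit_disk"
    by (subst emeasure_distr) (auto simp: space_restrict_space emeasure_restrict_space
        intro!: measurable_restrict_space1)
  also have "\<dots> < \<infinity>"
    by (rule emeasure_lborel_ball_finite)
  finally show "emeasure ?M {s<..} < \<infinity>" .
qed auto

lemma nn_integral_unit_disk_radial:
  assumes [measurable]: "h \<in> borel_measurable borel"
  shows "(\<integral>\<^sup>+z\<in>unit_disk. h ((cmod z)\<^sup>2) \<partial>lborel) = ennreal pi * (\<integral>\<^sup>+s\<in>{0..1}. h s \<partial>lborel)"
proof -
  have "(\<integral>\<^sup>+z\<in>unit_disk. h ((cmod z)\<^sup>2) \<partial>lborel)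
      = (\<integral>\<^sup>+s. h s \<partial>distr (restrict_space lborel unit_disk) borel (\<lambda>z. (cmod z)\<^sup>2))"
    by (subst nn_integral_distr)
      (auto simp: nn_integral_restrict_space intro!: measurable_restrict_space1)
  also have "\<dots> = ennreal pi * (\<integral>\<^sup>+s\<in>{0..1}. h s \<partial>lborel)"
    unfolding distr_cmod_square_unit_disk
    by (subst nn_integral_density)
      (auto simp: mult.assoc mult.commute[of "indicator _ _"] nn_integral_cmult)
  finally show ?thesis .
qed

lemma nn_integral_unit_disk_cmod_power:
  "(\<integral>\<^sup>+z\<in>unit_disk. ennreal (cmod z ^ (2 * k)) \<partial>lborel) = ennreal (pi / (real k + 1))"
proof -
  have "(\<integral>\<^sup>+s\<in>{0..1}. ennreal (s ^ k) \<partial>lborel)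
      = ennreal (1 ^ Suc k / real (Suc k) - 0 ^ Suc k / real (Suc k))"
  proof (rule nn_integral_FTC_Icc)
    fix s :: real
    show "((\<lambda>s. s ^ Suc k / real (Suc k)) has_real_derivative s ^ k) (at s)"
      using DERIV_cdivide[OF DERIV_pow[of "Suc k" s UNIV], of "real (Suc k)"]
      by (simp del: of_nat_Suc power_Suc)
  qed auto
  then show ?thesis
    using nn_integral_unit_disk_radial[of "\<lambda>s. ennreal (s ^ k)"]
    by (simp add: power_mult divide_inverse add.commute flip: ennreal_mult)
qed

lemma circle_mean_zero_extension_Re_holomorphic:
  assumes g: "g holomorphic_on unit_disk" and nonneg: "\<And>z. z \<in> unit_disk \<Longrightarrow> 0 \<le> Re (g z)"
    and r: "0 \<le> r" "r < 1"
  shows "circle_mean (zero_extension (\<lambda>z. ennreal (Re (g z)))) 0 r = ennreal (Re (g 0))"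
proof (cases "r = 0")
  case False
  have "circle_mean (zero_extension (\<lambda>z. ennreal (Re (g z)))) 0 r
      = circle_mean (\<lambda>z. ennreal (Re (g z))) 0 r"
    using r by (intro circle_mean_cong) (auto simp: zero_extension_def)
  also have "\<dots> = ennreal (Re (g 0))"
    using False r by (intro circle_mean_Re_holomorphic holomorphic_on_subset[OF g] nonneg) auto
  finally show ?thesis .
qed (simp add: zero_extension_def)

lemma has_bochner_integral_cmod_power_Re_holomorphic:
  assumes g: "g holomorphic_on unit_disk" and pos: "\<And>z. z \<in> unit_disk \<Longrightarrow> 0 < Re (g z)"
  shows "has_bochner_integral (weighted_area (\<lambda>z. ennreal (Re (g z))) 1) (\<lambda>z. cmod z ^ (2 * k))
    (Re (g 0) * (pi / (real k + 1)))"
proof (rule has_bochner_integral_nn_integral)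
  define \<omega> where "\<omega> = (\<lambda>z. ennreal (Re (g z)))"
  have w: "superharmonic_weight \<omega>"
    unfolding \<omega>_def by (rule superharmonic_weight_Re_holomorphic[OF assms])
  define \<phi> where "\<phi> t = ennreal (t ^ (2 * k)) * indicator {..<1} t" for t :: real
  have [measurable]: "\<phi> \<in> borel_measurable borel" "zero_extension \<omega> \<in> borel_measurable borel"
    unfolding \<phi>_def by (measurable, rule superharmonic_weight_zero_extension[OF w])
  show meas: "(\<lambda>z. cmod z ^ (2 * k)) \<in> borel_measurable (weighted_area \<omega> 1)"
    by (intro borel_measurable_weighted_area continuous_intros)
  have "(\<integral>\<^sup>+z. ennreal (cmod z ^ (2 * k)) \<partial>weighted_area \<omega> 1)
      = (\<integral>\<^sup>+z\<in>unit_disk. ennreal (cmod z ^ (2 * k)) * \<omega> z \<partial>lborel)"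
    using meas by (intro nn_integral_weighted_area[OF w]) auto
  also have "\<dots> = (\<integral>\<^sup>+z. \<phi> (cmod z) * zero_extension \<omega> z \<partial>lborel)"
    by (intro nn_integral_cong) (auto simp: \<phi>_def zero_extension_def indicator_def)
  also have "\<dots> = (\<integral>\<^sup>+z. \<phi> (cmod z) * circle_mean (zero_extension \<omega>) 0 (cmod z) \<partial>lborel)"
    by (rule nn_integral_radial_eq_circle_mean) measurable
  also have "\<dots> = (\<integral>\<^sup>+z. \<omega> 0 * (ennreal (cmod z ^ (2 * k)) * indicator unit_disk z) \<partial>lborel)"
  proof (rule nn_integral_cong)
    fix z :: complex
    have "circle_mean (zero_extension \<omega>) 0 (cmod z) = \<omega> 0" if "cmod z < 1"
      unfolding \<omega>_def
      using that by (intro circle_mean_zero_extension_Re_holomorphic g less_imp_le[OF pos]) auto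
    then show "\<phi> (cmod z) * circle_mean (zero_extension \<omega>) 0 (cmod z)
        = \<omega> 0 * (ennreal (cmod z ^ (2 * k)) * indicator unit_disk z)"
      by (simp add: \<phi>_def indicator_def mult.commute)
  qed
  also have "\<dots> = \<omega> 0 * ennreal (pi / (real k + 1))"
    by (subst nn_integral_cmult) (auto simp: nn_integral_unit_disk_cmod_power
        intro!: borel_measurable_times_ennreal borel_measurable_indicator)
  also have "\<dots> = ennreal (Re (g 0) * (pi / (real k + 1)))"
    using pos[of 0] unfolding \<omega>_def by (subst ennreal_mult) auto
  finally show "(\<integral>\<^sup>+z. ennreal (cmod z ^ (2 * k)) \<partial>weighted_area \<omega> 1)
      = ennreal (Re (g 0) * (pi / (real k + 1)))" .
  show "0 \<le> Re (g 0) * (pi / (real k + 1))"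
    using pos[of 0] by simp
qed auto

subsection \<open>The Poisson kernel at 1\<close>

definition poisson_one :: "complex \<Rightarrow> ennreal" where
  "poisson_one z = ennreal (Re ((1 + z) / (1 - z)))"

lemma Re_poisson_one: "Re ((1 + z) / (1 - z)) = (1 - (cmod z)\<^sup>2) / (cmod (1 - z))\<^sup>2"
proof -
  have "Re ((1 + z) / (1 - z)) = Re ((1 + z) * cnj (1 - z)) / (cmod (1 - z))\<^sup>2"
    by (subst complex_div_cnj) (rule Re_divide_of_real)
  also have "Re ((1 + z) * cnj (1 - z)) = 1 - (cmod z)\<^sup>2"
    unfolding cmod_power2 by (simp add: power2_eq_square algebra_simps)
  finally show ?thesis .
qed

lemma Re_poisson_one_pos:
  assumes "z \<in> unit_disk"
  shows "0 < Re ((1 + z) / (1 - z))"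
proof -
  have "z \<noteq> 1" "(cmod z)\<^sup>2 < 1"
    using assms by (auto simp: power_less_one_iff abs_square_less_1)
  then show ?thesis unfolding Re_poisson_one by simp
qed

lemma poisson_one_holomorphic: "(\<lambda>z. (1 + z) / (1 - z)) holomorphic_on unit_disk"
  by (intro holomorphic_intros) auto

lemma superharmonic_weight_poisson_one: "superharmonic_weight poisson_one"
  unfolding poisson_one_def[abs_def]
  by (intro superharmonic_weight_Re_holomorphic poisson_one_holomorphic Re_poisson_one_pos)

lemma has_bochner_integral_poisson_one_cmod_power:
  "has_bochner_integral (weighted_area poisson_one 1) (\<lambda>z. cmod z ^ (2 * k)) (pi / (real k + 1))"
  using has_bochner_integral_cmod_power_Re_holomorphic
      [OF poisson_one_holomorphic Re_poisson_one_pos]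
  by (simp add: poisson_one_def[abs_def])

lemma has_bochner_integral_poisson_one_cmod_power_mult:
  "has_bochner_integral (weighted_area poisson_one 1) (\<lambda>z. cmod z ^ (2 * k) * (cmod (1 - z))\<^sup>2)
    (pi / (real k + 1) - pi / (real k + 2))"
  unfolding poisson_one_def[abs_def] weighted_area_def
proof (rule has_bochner_integral_density)
  let ?A = "restrict_space lborel unit_disk"
  have area: "has_bochner_integral ?A (\<lambda>z. cmod z ^ (2 * j)) (pi / (real j + 1))" for j
    using has_bochner_integral_cmod_power_Re_holomorphic[of "\<lambda>_. 1" j]
    by (simp add: weighted_area_def density_1)
  have "has_bochner_integral ?A (\<lambda>z. cmod z ^ (2 * k) - cmod z ^ (2 * Suc k))
      (pi / (real k + 1) - pi / (real k + 2))"
    using has_bochner_integral_diff[OF area[of k] area[of "Suc k"]] by (simp add: add.commute)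
  moreover have "Re ((1 + z) / (1 - z)) *\<^sub>R (cmod z ^ (2 * k) * (cmod (1 - z))\<^sup>2)
      = cmod z ^ (2 * k) - cmod z ^ (2 * Suc k)" if "z \<in> space ?A" for z
  proof -
    have "cmod (1 - z) \<noteq> 0"
      using that by (auto simp: space_restrict_space)
    then show ?thesis
      unfolding Re_poisson_one by (simp add: power2_eq_square field_simps)
  qed
  ultimately show "has_bochner_integral ?A
      (\<lambda>z. Re ((1 + z) / (1 - z)) *\<^sub>R (cmod z ^ (2 * k) * (cmod (1 - z))\<^sup>2))
      (pi / (real k + 1) - pi / (real k + 2))"
    by (subst has_bochner_integral_cong[OF refl _ refl])
  show "AE z in ?A. 0 \<le> Re ((1 + z) / (1 - z))"
    using Re_poisson_one_pos by (intro AE_I2) (auto simp: space_restrict_space intro: less_imp_le)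
qed (auto intro!: measurable_restrict_space1 simp: measurable_lborel1)

lemma
  shows power_dirichlet_space_poisson_one: "(\<lambda>z. z ^ Suc k) \<in> dirichlet_space poisson_one"
    and energy_poisson_one_power: "energy poisson_one (\<lambda>z. z ^ Suc k) = pi * real (Suc k)"
proof -
  have "(cmod (deriv (\<lambda>z. z ^ Suc k) z))\<^sup>2 = (real (Suc k))\<^sup>2 * cmod z ^ (2 * k)" for z
  proof -
    have "deriv (\<lambda>z. z ^ Suc k) z = of_nat (Suc k) * z ^ k"
      using DERIV_power_Suc[OF DERIV_ident] by (intro DERIV_imp_deriv) simp
    then show ?thesis
      by (simp add: norm_mult norm_power power_mult_distrib mult.commute
          del: of_nat_Suc flip: power_mult)
  qed
  then have "has_bochner_integral (weighted_area poisson_one 1)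
      (\<lambda>z. (cmod (deriv (\<lambda>z. z ^ Suc k) z))\<^sup>2)
      ((real (Suc k))\<^sup>2 * (pi / (real k + 1)))"
    using has_bochner_integral_mult_right[OF has_bochner_integral_poisson_one_cmod_power] by simp
  moreover have "(real (Suc k))\<^sup>2 * (pi / (real k + 1)) = pi * real (Suc k)"
    by (simp add: power2_eq_square field_simps)
  ultimately show "(\<lambda>z. z ^ Suc k) \<in> dirichlet_space poisson_one"
    "energy poisson_one (\<lambda>z. z ^ Suc k) = pi * real (Suc k)"
    by (auto simp: dirichlet_space_def energy_def has_bochner_integral_iff
        intro!: holomorphic_intros)
qed

text \<open>The last term cancels the singularity of the weight at \<open>1\<close>.\<close>

lemma cmod_deriv_power_diff_square:
  "(cmod (deriv (\<lambda>z. z ^ Suc (Suc k) - z ^ Suc k) z))\<^sup>2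
    = (real k + 2) * cmod z ^ (2 * Suc k) - (real k + 1) * cmod z ^ (2 * k)
      + (real k + 1) * (real k + 2) * (cmod z ^ (2 * k) * (cmod (1 - z))\<^sup>2)"
proof -
  define m where "m = real k + 1"
  have "((\<lambda>z. z ^ Suc (Suc k) - z ^ Suc k) has_field_derivative
      (1 + of_nat (Suc k)) * (1 * z ^ Suc k) - (1 + of_nat k) * (1 * z ^ k)) (at z)"
    by (intro DERIV_diff DERIV_power_Suc[OF DERIV_ident])
  then have deriv: "deriv (\<lambda>z. z ^ Suc (Suc k) - z ^ Suc k) z
      = z ^ k * (of_real (m + 1) * z - of_real m)"
    by (simp add: DERIV_imp_deriv m_def algebra_simps)
  have square: "(cmod (of_real (m + 1) * z - of_real m))\<^sup>2
      = (m + 1) * (cmod z)\<^sup>2 - m + m * (m + 1) * (cmod (1 - z))\<^sup>2"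
    unfolding cmod_power2 by (simp add: power2_eq_square algebra_simps)
  have "(cmod (deriv (\<lambda>z. z ^ Suc (Suc k) - z ^ Suc k) z))\<^sup>2
      = cmod z ^ (2 * k) * ((m + 1) * (cmod z)\<^sup>2 - m + m * (m + 1) * (cmod (1 - z))\<^sup>2)"
    unfolding deriv norm_mult power_mult_distrib square by (simp add: norm_power power_even_eq)
  then show ?thesis
    by (simp add: m_def power2_eq_square algebra_simps)
qed

lemma nn_integral_poisson_one_deriv_power_diff:
  "(\<integral>\<^sup>+z. ennreal ((cmod (deriv (\<lambda>z. z ^ Suc (Suc k) - z ^ Suc k) z))\<^sup>2)
      \<partial>weighted_area poisson_one 1) = ennreal pi"
proof -
  define m where "m = real k + 1"
  have m: "0 < m" "real (Suc k) + 1 = m + 1" "real k + 1 = m" "real k + 2 = m + 1"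
    by (simp_all add: m_def)
  have "has_bochner_integral (weighted_area poisson_one 1)
      (\<lambda>z. (cmod (deriv (\<lambda>z. z ^ Suc (Suc k) - z ^ Suc k) z))\<^sup>2)
      ((real k + 2) * (pi / (real (Suc k) + 1)) - (real k + 1) * (pi / (real k + 1))
        + (real k + 1) * (real k + 2) * (pi / (real k + 1) - pi / (real k + 2)))"
    unfolding cmod_deriv_power_diff_square
    by (intro has_bochner_integral_add has_bochner_integral_diff has_bochner_integral_mult_right
        has_bochner_integral_poisson_one_cmod_power
        has_bochner_integral_poisson_one_cmod_power_mult)
  moreover have "(m + 1) * (pi / (m + 1)) = pi" "m * (pi / m) = pi"
    "m * (m + 1) * (pi / m - pi / (m + 1)) = pi"
    using m(1) by (simp_all add: divide_simps) (simp add: distrib_left)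
  ultimately have "has_bochner_integral (weighted_area poisson_one 1)
      (\<lambda>z. (cmod (deriv (\<lambda>z. z ^ Suc (Suc k) - z ^ Suc k) z))\<^sup>2) pi"
    unfolding m(2-4) by simp
  then show ?thesis
    by (simp add: has_bochner_integral_iff nn_integral_eq_integral)
qed

subsection \<open>A lacunary function\<close>

lemma square_norm_sum_le_weighted:
  fixes d :: "'i \<Rightarrow> 'a::real_normed_vector"
  assumes c: "\<And>i. i \<in> I \<Longrightarrow> 0 \<le> c i" "(\<Sum>i\<in>I. c i) \<le> 1"
  shows "(norm (\<Sum>i\<in>I. c i *\<^sub>R d i))\<^sup>2 \<le> (\<Sum>i\<in>I. c i * (norm (d i))\<^sup>2)"
proof -
  have "norm (\<Sum>i\<in>I. c i *\<^sub>R d i) \<le> (\<Sum>i\<in>I. sqrt (c i) * (sqrt (c i) * norm (d i)))"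
    using c(1) by (intro order_trans[OF norm_sum sum_mono]) (simp flip: mult.assoc)
  then have "(norm (\<Sum>i\<in>I. c i *\<^sub>R d i))\<^sup>2 \<le> (\<Sum>i\<in>I. sqrt (c i) * (sqrt (c i) * norm (d i)))\<^sup>2"
    by (intro power_mono) auto
  also have "\<dots> \<le> (\<Sum>i\<in>I. (sqrt (c i))\<^sup>2) * (\<Sum>i\<in>I. (sqrt (c i) * norm (d i))\<^sup>2)"
    by (rule Cauchy_Schwarz_ineq_sum)
  also have "\<dots> = (\<Sum>i\<in>I. c i) * (\<Sum>i\<in>I. c i * (norm (d i))\<^sup>2)"
    using c(1) by (simp add: power_mult_distrib)
  also have "\<dots> \<le> (\<Sum>i\<in>I. c i * (norm (d i))\<^sup>2)"
    using c by (intro mult_left_le_one_le sum_nonneg) auto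
  finally show ?thesis .
qed

definition lacunary_term :: "nat \<Rightarrow> complex \<Rightarrow> complex" where
  "lacunary_term j z = (1/2) ^ Suc j * (z ^ Suc (4 ^ Suc j) - z ^ (4 ^ Suc j))"

definition lacunary :: "complex \<Rightarrow> complex" where
  "lacunary z = (\<Sum>j. lacunary_term j z)"

lemma lacunary_term_holomorphic: "lacunary_term j holomorphic_on A"
  unfolding lacunary_term_def[abs_def] by (intro holomorphic_intros)

lemma uniform_limit_lacunary:
  "uniform_limit unit_disk (\<lambda>K z. \<Sum>j<K. lacunary_term j z) lacunary sequentially"
proof -
  have "cmod (lacunary_term j z) \<le> (1/2) ^ j" if "z \<in> unit_disk" for j z
  proof -
    have "cmod (z ^ Suc n - z ^ n) \<le> 1 + 1" for n
      using that by (intro order_trans[OF norm_triangle_ineq4 add_mono])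
        (simp_all add: norm_power norm_mult power_le_one mult_le_one)
    then have "cmod (lacunary_term j z) \<le> (1/2) ^ Suc j * (1 + 1)"
      unfolding lacunary_term_def norm_mult by (intro mult_mono) (auto simp: norm_power norm_divide)
    then show ?thesis by simp
  qed
  then show ?thesis
    unfolding lacunary_def[abs_def] by (rule Weierstrass_m_test) (simp_all add: summable_geometric)
qed

lemma lacunary_holomorphic: "lacunary holomorphic_on unit_disk"
proof (rule holomorphic_uniform_sequence)
  fix z assume "z \<in> unit_disk"
  then obtain d where "0 < d" "cball z d \<subseteq> unit_disk"
    by (meson open_ball open_contains_cball)
  then show "\<exists>d. 0 < d \<and> cball z d \<subseteq> unit_disk
      \<and> uniform_limit (cball z d) (\<lambda>K z. \<Sum>j<K. lacunary_term j z) lacunary sequentially"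
    using uniform_limit_on_subset[OF uniform_limit_lacunary] by blast
qed (auto intro!: holomorphic_intros lacunary_term_holomorphic)

lemma higher_deriv_sum:
  assumes "\<And>i. i \<in> I \<Longrightarrow> f i holomorphic_on S" "open S" "z \<in> S"
  shows "(deriv ^^ n) (\<lambda>w. \<Sum>i\<in>I. f i w) z = (\<Sum>i\<in>I. (deriv ^^ n) (f i) z)"
  using assms
proof (induction I rule: infinite_finite_induct)
  case (insert i I)
  then show ?case
    by (simp add: higher_deriv_add[where S = S] holomorphic_on_sum)
qed auto

lemma higher_deriv_lacunary_sums:
  assumes "z \<in> unit_disk"
  shows "(\<lambda>j. (deriv ^^ n) (lacunary_term j) z) sums (deriv ^^ n) lacunary z"
proof -
  have "(\<lambda>K. (deriv ^^ n) (\<lambda>w. \<Sum>j<K. lacunary_term j w) z) \<longlonglongrightarrow> (deriv ^^ n) lacunary z"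
    using assms
    by (intro higher_deriv_complex_uniform_limit[OF uniform_limit_lacunary] always_eventually allI
        holomorphic_intros lacunary_term_holomorphic) auto
  moreover have "(deriv ^^ n) (\<lambda>w. \<Sum>j<K. lacunary_term j w) z
      = (\<Sum>j<K. (deriv ^^ n) (lacunary_term j) z)" for K
    by (rule higher_deriv_sum[OF lacunary_term_holomorphic open_ball assms])
  ultimately show ?thesis by (simp add: sums_def)
qed

lemma taylor_coeff_lacunary_term:
  "taylor_coeff (lacunary_term j) n
    = (1/2) ^ Suc j * (of_bool (n = Suc (4 ^ Suc j)) - of_bool (n = 4 ^ Suc j))"
proof -
  have "lacunary_term j has_fps_expansion
      fps_const ((1/2) ^ Suc j) * (fps_X ^ Suc (4 ^ Suc j) - fps_X ^ (4 ^ Suc j))"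
    unfolding lacunary_term_def[abs_def] by (intro fps_expansion_intros)
  from fps_nth_fps_expansion[OF this, of n] show ?thesis
    by (simp add: taylor_coeff_def fps_X_power_nth of_bool_def del: power_Suc)
qed

lemma taylor_coeff_lacunary_power: "taylor_coeff lacunary (4 ^ Suc i) = - ((1/2) ^ Suc i)"
proof -
  have "(4::nat) ^ Suc i \<noteq> Suc (4 ^ Suc j)" for j
    by (metis even_Suc even_numeral even_power zero_less_Suc)
  then have "(\<lambda>j. taylor_coeff (lacunary_term j) (4 ^ Suc i))
      = (\<lambda>j. if j = i then - ((1/2) ^ Suc i) else 0)"
    by (auto simp: taylor_coeff_lacunary_term simp del: power_Suc)
  moreover have "(\<lambda>j. taylor_coeff (lacunary_term j) (4 ^ Suc i))
      sums taylor_coeff lacunary (4 ^ Suc i)"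
    unfolding taylor_coeff_def by (intro sums_divide higher_deriv_lacunary_sums) simp
  ultimately have "(\<lambda>j. if j = i then - ((1/2) ^ Suc i) else 0)
      sums taylor_coeff lacunary (4 ^ Suc i)"
    by (simp only:)
  then show ?thesis
    by (rule sums_unique2[OF _ sums_single[of i "\<lambda>_. - ((1/2) ^ Suc i)"]])
qed

lemma deriv_lacunary_square_le:
  assumes z: "z \<in> unit_disk"
  shows "ennreal ((cmod (deriv lacunary z))\<^sup>2) \<le> (\<Sum>j. ennreal ((1/2) ^ Suc j)
    * ennreal ((cmod (deriv (\<lambda>z. z ^ Suc (4 ^ Suc j) - z ^ (4 ^ Suc j)) z))\<^sup>2))"
proof -
  define d where "d j = deriv (\<lambda>z. z ^ Suc (4 ^ Suc j) - z ^ (4 ^ Suc j)) z" for j :: nat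
  have "deriv (lacunary_term j) z = (1/2) ^ Suc j *\<^sub>R d j" for j
  proof -
    have "(\<lambda>z. z ^ Suc (4 ^ Suc j) - z ^ (4 ^ Suc j)) field_differentiable at z"
      by (intro holomorphic_on_imp_differentiable_at[of _ UNIV] holomorphic_intros) auto
    then show ?thesis
      unfolding lacunary_term_def[abs_def] d_def by (subst deriv_cmult)
        (auto simp: scaleR_conv_of_real)
  qed
  then have sums: "(\<lambda>j. (1/2) ^ Suc j *\<^sub>R d j) sums deriv lacunary z"
    using higher_deriv_lacunary_sums[OF z, of 1] by simp
  have "(cmod (\<Sum>j<K. (1/2) ^ Suc j *\<^sub>R d j))\<^sup>2 \<le> (\<Sum>j<K. (1/2) ^ Suc j * (cmod (d j))\<^sup>2)" for K
    using sum_le_suminf[OF sums_summable[OF power_half_series], of "{..<K}"]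
      sums_unique[OF power_half_series]
    by (intro square_norm_sum_le_weighted) auto
  then have "ennreal ((cmod (\<Sum>j<K. (1/2) ^ Suc j *\<^sub>R d j))\<^sup>2)
      \<le> (\<Sum>j<K. ennreal ((1/2) ^ Suc j) * ennreal ((cmod (d j))\<^sup>2))" for K
    by (simp add: ennreal_leI flip: ennreal_mult)
  then have le: "ennreal ((cmod (\<Sum>j<K. (1/2) ^ Suc j *\<^sub>R d j))\<^sup>2)
      \<le> (\<Sum>j. ennreal ((1/2) ^ Suc j) * ennreal ((cmod (d j))\<^sup>2))" for K
    by (rule order_trans[OF _ sum_le_suminf]) auto
  have "(\<lambda>K. ennreal ((cmod (\<Sum>j<K. (1/2) ^ Suc j *\<^sub>R d j))\<^sup>2))
      \<longlonglongrightarrow> ennreal ((cmod (deriv lacunary z))\<^sup>2)"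
    using sums unfolding sums_def by (intro tendsto_ennrealI tendsto_intros)
  then show ?thesis
    unfolding d_def[symmetric] by (rule LIMSEQ_le_const2) (use le in auto)
qed

lemma lacunary_dirichlet_space: "lacunary \<in> dirichlet_space poisson_one"
proof -
  define p where "p j = (\<lambda>z. z ^ Suc (4 ^ Suc j) - z ^ (4 ^ Suc j) :: complex)" for j :: nat
  have [measurable]: "deriv (p j) \<in> borel_measurable (weighted_area poisson_one 1)" for j
    unfolding p_def by (intro borel_measurable_deriv holomorphic_intros)
  have energy: "(\<integral>\<^sup>+z. ennreal ((cmod (deriv (p j) z))\<^sup>2) \<partial>weighted_area poisson_one 1)
      = ennreal pi" for j
  proof -
    obtain k where "(4::nat) ^ Suc j = Suc k"
      using not0_implies_Suc[of "4 ^ Suc j"] by auto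
    then show ?thesis
      unfolding p_def by (simp only: nn_integral_poisson_one_deriv_power_diff)
  qed
  have "(\<integral>\<^sup>+z. ennreal ((cmod (deriv lacunary z))\<^sup>2) \<partial>weighted_area poisson_one 1)
      \<le> (\<integral>\<^sup>+z. (\<Sum>j. ennreal ((1/2) ^ Suc j) * ennreal ((cmod (deriv (p j) z))\<^sup>2))
            \<partial>weighted_area poisson_one 1)"
    unfolding p_def by (intro nn_integral_mono deriv_lacunary_square_le) simp
  also have "\<dots> = (\<Sum>j. ennreal ((1/2) ^ Suc j) * ennreal pi)"
    by (subst nn_integral_suminf) (auto simp: nn_integral_cmult energy)
  also have "\<dots> = ennreal pi"
    unfolding ennreal_suminf_multc by (subst suminf_ennreal_eq[OF _ power_half_series]) auto
  finally show ?thesis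
    by (simp add: dirichlet_space_iff_nn_integral[OF lacunary_holomorphic] le_less_trans)
qed

subsection \<open>Divergence of the partial sums\<close>

lemma partial_sum_dirichlet_space_poisson_one: "partial_sum n f \<in> dirichlet_space poisson_one"
proof (induction n)
  case 0
  show ?case
    by (simp add: partial_sum_def[abs_def] dirichlet_space_def)
next
  case (Suc n)
  then show ?case
    using dirichlet_space_lincomb[OF Suc power_dirichlet_space_poisson_one,
        of 1 "taylor_coeff f (Suc n)" n]
    by (simp add: partial_sum_def[abs_def])
qed

lemma energy_taylor_term_le:
  assumes f: "f \<in> dirichlet_space \<omega>" and s: "\<And>n. partial_sum n f \<in> dirichlet_space \<omega>"
  shows "energy \<omega> (\<lambda>z. taylor_coeff f (Suc n) * z ^ Suc n)
    \<le> 2 * energy \<omega> (\<lambda>z. partial_sum (Suc n) f z - f z) + 2 * energy \<omega> (\<lambda>z. partial_sum n f z - f z)"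
proof -
  define r where "r n = (\<lambda>z. partial_sum n f z - f z)" for n
  have r: "r n \<in> dirichlet_space \<omega>" for n
    unfolding r_def using dirichlet_space_lincomb[OF s f, of 1 n "-1"] by simp
  have "(\<lambda>z. taylor_coeff f (Suc n) * z ^ Suc n) = (\<lambda>z. r (Suc n) z - r n z)"
    by (auto simp: r_def partial_sum_def)
  then show ?thesis
    using energy_parallelogram[OF r[of "Suc n"] r[of n]]
      energy_nonneg[of \<omega> "\<lambda>z. r (Suc n) z + r n z"]
    by (simp add: r_def)
qed

lemma D_norm_sq_partial_sum_lacunary_not_LIMSEQ_0:
  "\<not> (\<lambda>n. D_norm_sq poisson_one (\<lambda>z. partial_sum n lacunary z - lacunary z)) \<longlonglongrightarrow> 0"
proof
  define E where "E n = energy poisson_one (\<lambda>z. partial_sum n lacunary z - lacunary z)" for n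
  have "partial_sum n lacunary 0 = lacunary 0" for n
    using partial_sum_add_taylor_tail[OF lacunary_holomorphic, of 0 n] by simp
  then have "D_norm_sq poisson_one (\<lambda>z. partial_sum n lacunary z - lacunary z)
      = ennreal (E n / pi)" for n
    unfolding E_def
    by (intro D_norm_sq_diff_eq_energy superharmonic_weight_poisson_one
        partial_sum_dirichlet_space_poisson_one lacunary_dirichlet_space)
  moreover assume "(\<lambda>n. D_norm_sq poisson_one (\<lambda>z. partial_sum n lacunary z - lacunary z)) \<longlonglongrightarrow> 0"
  ultimately have "(\<lambda>n. ennreal (E n / pi)) \<longlonglongrightarrow> ennreal 0"
    by simp
  then have "(\<lambda>n. E n / pi) \<longlonglongrightarrow> 0"
    by (rule tendsto_ennrealD) (auto simp: E_def energy_nonneg)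
  then have "\<forall>\<^sub>F n in sequentially. E n / pi < 1/4"
    by (rule order_tendstoD(2)) simp
  then obtain N where N: "\<And>n. N \<le> n \<Longrightarrow> E n / pi < 1/4"
    by (auto simp: eventually_sequentially)
  obtain n where n: "Suc n = 4 ^ Suc N"
    using not0_implies_Suc[of "4 ^ Suc N"] by (metis power_not_zero zero_neq_numeral)
  have "Suc N < 4 ^ Suc N"
    by (rule less_le_trans[OF less_exp power_mono]) auto
  then have "N \<le> n" using n by linarith
  have "energy poisson_one (\<lambda>z. taylor_coeff lacunary (Suc n) * z ^ Suc n)
      = (cmod (taylor_coeff lacunary (Suc n)))\<^sup>2 * (pi * real (Suc n))"
    unfolding energy_poisson_one_power[symmetric] by (intro energy_cmult holomorphic_intros)
  also have "\<dots> = ((1/2) ^ Suc N)\<^sup>2 * (pi * 4 ^ Suc N)"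
    unfolding n taylor_coeff_lacunary_power by (simp add: norm_power norm_mult norm_divide)
  also have "\<dots> = pi"
    by (simp add: power_mult_distrib power_divide power2_eq_square flip: power_mult_distrib)
  finally have "pi \<le> 2 * E (Suc n) + 2 * E n"
    using energy_taylor_term_le
        [OF lacunary_dirichlet_space partial_sum_dirichlet_space_poisson_one, of n]
    by (simp add: E_def)
  moreover have "E (Suc n) < pi / 4" "E n < pi / 4"
    using N[of n] N[of "Suc n"] \<open>N \<le> n\<close> by (auto simp: field_simps)
  ultimately show False by linarith
qed

theorem theorem6:
  shows "(\<forall>\<omega> f. superharmonic_weight \<omega> \<longrightarrow> in_D \<omega> f \<longrightarrow>
            (\<lambda>n. D_norm_sq \<omega> (\<lambda>z. cesaro_mean n f z - f z)) \<longlonglongrightarrow> 0)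
       \<and> (\<exists>\<omega> f. superharmonic_weight \<omega> \<and> in_D \<omega> f \<and>
            \<not> ((\<lambda>n. D_norm_sq \<omega> (\<lambda>z. partial_sum n f z - f z)) \<longlonglongrightarrow> 0))"
proof (intro conjI allI impI exI)
  fix \<omega> f assume w: "superharmonic_weight \<omega>" and "in_D \<omega> f"
  then have "f \<in> dirichlet_space \<omega>"
    by (simp add: in_D_iff_dirichlet_space)
  with w show "(\<lambda>n. D_norm_sq \<omega> (\<lambda>z. cesaro_mean n f z - f z)) \<longlonglongrightarrow> 0"
    by (rule D_norm_sq_cesaro_mean_diff_LIMSEQ_0)
next
  show "superharmonic_weight poisson_one"
    by (rule superharmonic_weight_poisson_one)
  then show "in_D poisson_one lacunary"
    using lacunary_dirichlet_space by (simp add: in_D_iff_dirichlet_space)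
  show "\<not> (\<lambda>n. D_norm_sq poisson_one (\<lambda>z. partial_sum n lacunary z - lacunary z)) \<longlonglongrightarrow> 0"
    by (rule D_norm_sq_partial_sum_lacunary_not_LIMSEQ_0)
qed

end
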